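(* Let $G$ be any tree (a connected graph without cycles) with $r$ edges, and $c\in(0,1)$. We have $$d_K\big(\widetilde N^G_n,\mathcal N\big)\lesssim\begin{cases}\dfrac{1}{n\sqrt{1-p_n}} & \text{if } c<p_n<1,\\[2mm] \dfrac{1}{n\sqrt{p_n}} & \text{if } \dfrac1n<p_n\le c,\\[2mm] \dfrac{1}{n^{(r+1)/2}p_n^{r/2}} & \text{if } 0<p_n\le \dfrac1n.\end{cases}$$
   Context: For positive functions $f,g$, the notation $f\lesssim g$ means that $f\le C_G\,g$ for some constant $C_G>0$ depending only on $G$. $\mathbb G_n(p_n)$ is the Erdős–Rényi random graph obtained by independently retaining each edge of the complete graph $K_n$ on $n$ vertices with probability $p_n\in(0,1)$. $N^G_n$ is the number of (not necessarily induced) subgraphs of $\mathbb G_n(p_n)$ isomorphic to $G$, and $$\widetilde N^G_n=\frac{N^G_n-\mathbb E[N^G_n]}{\sqrt{\mathrm{Var}[N^G_n]}}.$$ $d_K(F,\mathcal N)=\sup_{x\in\mathbb R}|P(F\le x)-P(\mathcal N\le x)|$ is the Kolmogorov distance, where $\mathcal N$ is a standard normal random variable.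
   Formalization: The implied constant is allowed to depend on c as well as on G (a constant depending only on G is impossible, e.g. a single edge with p_n = 1/n and c = 1/(2n)); r ≥ 1 and n ≥ the number of vertices of G are assumed so that the variance is nonzero. *)

theory Defs
  imports "HOL-Probability.Probability" "HOL-Library.Ramsey"
begin

text \<open>A finite simple graph is a vertex set \<open>V\<close> together with an edge set \<open>E\<close> consisting of
  two-element subsets of \<open>V\<close>.\<close>

definition simple_graph :: "'a set \<Rightarrow> 'a set set \<Rightarrow> bool" where
  "simple_graph V E \<longleftrightarrow> finite V \<and> E \<subseteq> nsets V 2"

definition connected_graph :: "'a set \<Rightarrow> 'a set set \<Rightarrow> bool" where
  "connected_graph V E \<longleftrightarrow>
     V \<noteq> {} \<and> (\<forall>u\<in>V. \<forall>v\<in>V. (u, v) \<in> {(x, y). {x, y} \<in> E}\<^sup>*)"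

text \<open>A cycle is given by the list of its (distinct) vertices; the edge closing it up is the one
  from the last vertex back to the first, whence the index modulo the length.\<close>

definition is_cycle :: "'a set set \<Rightarrow> 'a list \<Rightarrow> bool" where
  "is_cycle E xs \<longleftrightarrow> length xs \<ge> 3 \<and> distinct xs \<and>
     (\<forall>i<length xs. {xs ! i, xs ! (Suc i mod length xs)} \<in> E)"

definition is_tree :: "'a set \<Rightarrow> 'a set set \<Rightarrow> bool" where
  "is_tree V E \<longleftrightarrow> simple_graph V E \<and> connected_graph V E \<and> (\<nexists>xs. is_cycle E xs)"

definition graph_isomorphic :: "'a set \<Rightarrow> 'a set set \<Rightarrow> 'b set \<Rightarrow> 'b set set \<Rightarrow> bool" where
  "graph_isomorphic V E W F \<longleftrightarrow> (\<exists>f. bij_betw f V W \<and> ((`) f) ` E = F)"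

text \<open>The number of subgraphs \<open>(W, F)\<close> of \<open>(U, H)\<close>, not necessarily induced, that are isomorphic
  to \<open>(V, E)\<close>.\<close>

definition subgraph_count :: "'a set \<Rightarrow> 'a set set \<Rightarrow> 'b set \<Rightarrow> 'b set set \<Rightarrow> nat" where
  "subgraph_count V E U H =
     card {(W, F). W \<subseteq> U \<and> F \<subseteq> H \<and> simple_graph W F \<and> graph_isomorphic V E W F}"

text \<open>The law of the (random) edge set of the Erdos-Renyi graph on the vertex set \<open>{..<n}\<close>: the
  indicators of the edges of the complete graph are independent Bernoulli variables.\<close>

definition erdos_renyi :: "nat \<Rightarrow> real \<Rightarrow> nat set set pmf" where
  "erdos_renyi n p =
     map_pmf (\<lambda>\<omega>. {e \<in> nsets {..<n} 2. \<omega> e})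
       (Pi_pmf (nsets {..<n} 2) False (\<lambda>_. bernoulli_pmf p))"

definition normalized_count :: "'a set \<Rightarrow> 'a set set \<Rightarrow> nat \<Rightarrow> real \<Rightarrow> nat set set \<Rightarrow> real" where
  "normalized_count V E n p H =
     (let N = (\<lambda>H. real (subgraph_count V E {..<n} H)) in
      (N H - measure_pmf.expectation (erdos_renyi n p) N)
        / sqrt (measure_pmf.variance (erdos_renyi n p) N))"

text \<open>The Kolmogorov distance of two probability measures on the real line; for random variables
  it is applied to their laws.\<close>

definition kolmogorov_dist :: "real measure \<Rightarrow> real measure \<Rightarrow> real" where
  "kolmogorov_dist M N = (SUP x. \<bar>cdf M x - cdf N x\<bar>)"

definition normal_approx_error :: "'a set \<Rightarrow> 'a set set \<Rightarrow> nat \<Rightarrow> real \<Rightarrow> real" where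
  "normal_approx_error V E n p =
     kolmogorov_dist
       (distr (measure_pmf (erdos_renyi n p)) borel (normalized_count V E n p))
       std_normal_distribution"

end

theory Submission
  imports Defs "HOL-Real_Asymp.Real_Asymp"
begin

text \<open>Write \<open>X\<^sub>e\<close> for the indicator of the edge \<open>e\<close>, \<open>N\<close> for the number of copies and \<open>\<nabla>\<^sub>e N\<close> for
  the increment of \<open>N\<close> when \<open>e\<close> is switched on. Fix an ordering of the edges and let \<open>u\<^sub>e\<close> be the
  conditional expectation of \<open>\<nabla>\<^sub>e N\<close> given the edges before \<open>e\<close>. The martingale decomposition
  \<open>N - E N = \<Sum>\<^sub>e (X\<^sub>e - p) u\<^sub>e\<close> and integration by parts turn \<open>E [W f(W)]\<close> in Stein's equation into
  \<open>p (1 - p) \<Sum>\<^sub>e E [u\<^sub>e (f(W\<^sub>e\<^sup>+) - f(W\<^sub>e\<^sup>-))]\<close>. Replacing the increment of \<open>f\<close> by \<open>f'(W) \<nabla>\<^sub>e W\<close> costs at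
  most \<open>\<nabla>\<^sub>e W\<close> times the increment of a bounded nondecreasing function \<open>g\<close>; as \<open>\<nabla>\<^sub>e N \<ge> 0\<close>, a second
  integration by parts, in the opposite direction, sums these errors without loss. With
  \<open>v\<^sub>e = u\<^sub>e \<nabla>\<^sub>e N\<close> the Kolmogorov distance is thus at most
  \<open>2 \<sigma>\<^sup>-\<^sup>2 (E |p (1 - p) \<Sum>\<^sub>e v\<^sub>e - \<sigma>\<^sup>2| + E |\<Sum>\<^sub>e (X\<^sub>e - p) v\<^sub>e|)\<close>.
  The second moments of both terms are bounded by a sum over quadruples of copies in which each
  copy shares an edge with an earlier one. A subforest with \<open>k \<ge> 1\<close> edges has at least \<open>k + 1\<close>
  vertices, so each such overlap costs the factor \<open>\<Psi> = min (n\<^sup>2 p) (n\<^sup>r\<^sup>+\<^sup>1 p\<^sup>r)\<close>, and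
  the distance is \<open>O (((1 - p) \<Psi>)\<^sup>-\<^sup>1\<^sup>/\<^sup>2)\<close>.\<close>

section \<open>Stein's equation\<close>

abbreviation std_normal_cdf :: "real \<Rightarrow> real" where
  "std_normal_cdf \<equiv> cdf std_normal_distribution"

lemma std_normal_density_has_derivative [derivative_intros]:
  "(std_normal_density has_real_derivative - x * std_normal_density x) (at x)"
proof -
  have "((\<lambda>x. exp (- x\<^sup>2 / 2)) has_real_derivative - x * exp (- x\<^sup>2 / 2)) (at x)"
    by (auto intro!: derivative_eq_intros)
  from DERIV_cmult[OF this, of "1 / sqrt (2 * pi)"]
  have "((\<lambda>x. (1 / sqrt (2 * pi)) * exp (- x\<^sup>2 / 2)) has_real_derivative
     - x * ((1 / sqrt (2 * pi)) * exp (- x\<^sup>2 / 2))) (at x)"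
    by simp
  moreover have "std_normal_density = (\<lambda>x. (1 / sqrt (2 * pi)) * exp (- x\<^sup>2 / 2))"
    by (simp add: std_normal_density_def fun_eq_iff)
  ultimately show ?thesis by simp
qed

text \<open>Passes from the Lebesgue integral to the gauge integral over a compact interval, where
  the fundamental theorem of calculus applies.\<close>

lemma std_normal_cdf_diff:
  assumes "a \<le> y"
  shows "std_normal_cdf y = std_normal_cdf a + integral {a..y} std_normal_density"
proof (cases "a = y")
  case False
  then have "a < y" using assms by simp
  interpret real_distribution std_normal_distribution by (rule real_dist_normal_dist)
  have "std_normal_cdf y - std_normal_cdf a = measure std_normal_distribution {a<..y}"
    by (rule cdf_diff_eq) fact
  also have "\<dots> = (\<integral>x. indicator {a<..y} x \<partial>std_normal_distribution)"
    by simp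
  also have "\<dots> = (\<integral>x. std_normal_density x * indicator {a<..y} x \<partial>lborel)"
    by (subst integral_real_density) auto
  also have "\<dots> = set_lebesgue_integral lborel {a<..y} std_normal_density"
    by (simp add: set_lebesgue_integral_def mult.commute)
  also have "\<dots> = integral {a<..y} std_normal_density"
    by (rule set_borel_integral_eq_integral)
       (use integrable_mult_indicator[of "{a<..y}" lborel std_normal_density] in
         \<open>simp add: set_integrable_def\<close>)
  also have "\<dots> = integral {a..y} std_normal_density"
    by (rule integral_subset_negligible) (auto intro: negligible_subset[of "{a}"])
  finally show ?thesis by simp
qed simp

lemma std_normal_cdf_has_derivative [derivative_intros]:
  "(std_normal_cdf has_real_derivative std_normal_density x) (at x)"
proof -
  have "continuous_on {x - 1..x + 1} std_normal_density"
    by (meson DERIV_continuous continuous_at_imp_continuous_on std_normal_density_has_derivative)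
  then have "((\<lambda>y. integral {x - 1..y} std_normal_density) has_real_derivative std_normal_density x)
      (at x within {x - 1..x + 1})"
    by (rule integral_has_real_derivative) simp
  then have "((\<lambda>y. std_normal_cdf (x - 1) + integral {x - 1..y} std_normal_density)
      has_real_derivative std_normal_density x) (at x within {x - 1..x + 1})"
    by (auto intro!: derivative_eq_intros)
  then have "(std_normal_cdf has_real_derivative std_normal_density x) (at x within {x - 1..x + 1})"
    by (rule has_field_derivative_transform_within[of _ _ _ _ 1])
       (auto intro!: std_normal_cdf_diff[symmetric])
  moreover have "at x within {x - 1..x + 1} = at x"
    by (rule at_within_interior) auto
  ultimately show ?thesis by simp
qed

lemma std_normal_density_gt_0: "std_normal_density x > 0"
  by (rule normal_density_pos) simp

lemma std_normal_cdf_lims: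
  "(std_normal_cdf \<longlongrightarrow> 0) at_bot" "(std_normal_cdf \<longlongrightarrow> 1) at_top"
proof -
  interpret real_distribution std_normal_distribution by (rule real_dist_normal_dist)
  show "(std_normal_cdf \<longlongrightarrow> 0) at_bot" "(std_normal_cdf \<longlongrightarrow> 1) at_top"
    by (rule cdf_lim_at_bot, rule cdf_lim_at_top_prob)
qed

lemma std_normal_cdf_bounds: "0 \<le> std_normal_cdf x" "std_normal_cdf x \<le> 1"
proof -
  interpret real_distribution std_normal_distribution by (rule real_dist_normal_dist)
  show "0 \<le> std_normal_cdf x" "std_normal_cdf x \<le> 1"
    by (rule cdf_nonneg, rule cdf_bounded_prob)
qed

text \<open>\<open>std_normal_cdf (- x) + std_normal_cdf x\<close> is constant because the density
  is even; the limit at infinity shows that the constant is 1.\<close>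

lemma std_normal_cdf_minus: "std_normal_cdf (- x) = 1 - std_normal_cdf x"
proof -
  have d: "((\<lambda>x. std_normal_cdf (- x) + std_normal_cdf x) has_real_derivative 0) (at x)" for x
  proof -
    have "std_normal_density (- x) = std_normal_density x"
      by (simp add: std_normal_density_def)
    then show ?thesis
      by (auto intro!: derivative_eq_intros DERIV_chain2[of std_normal_cdf])
  qed
  then have "std_normal_cdf (- y) + std_normal_cdf y = std_normal_cdf (- x) + std_normal_cdf x" for y
    using DERIV_isconst_all by blast
  then obtain K where K: "std_normal_cdf (- y) + std_normal_cdf y = K" for y by blast
  have "((\<lambda>y. std_normal_cdf (- y) + std_normal_cdf y) \<longlongrightarrow> 0 + 1) at_top"
    by (intro tendsto_add std_normal_cdf_lims
          filterlim_compose[OF std_normal_cdf_lims(1) filterlim_uminus_at_bot_at_top])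
  then have "K = 1"
    by (simp add: K tendsto_const_iff)
  then show ?thesis using K[of x] by simp
qed

lemma std_normal_cdf_pos: "0 < std_normal_cdf x"
  by (rule DERIV_pos_imp_increasing_at_bot[OF _ std_normal_cdf_lims(1)])
     (auto intro!: exI std_normal_cdf_has_derivative simp: std_normal_density_gt_0)

section \<open>Bounds for the Mills ratio\<close>

lemma mills_lower: "- x * std_normal_density x \<le> (1 + x\<^sup>2) * std_normal_cdf x"
proof -
  \<comment> \<open>Up to the positive factor \<open>1 + x^2\<close> the claim is that
    \<open>g x\<close> is nonnegative; \<open>g\<close> tends to 0 at minus infinity and has
    positive derivative.\<close>
  define g where "g = (\<lambda>w. std_normal_cdf w + w * std_normal_density w / (1 + w\<^sup>2))"
  have nz: "1 + w\<^sup>2 \<noteq> 0" for w :: real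
    using add_pos_nonneg[OF zero_less_one zero_le_power2[of w]] by simp
  have "(g has_real_derivative std_normal_density w * (2 / (1 + w\<^sup>2)\<^sup>2)) (at w)" for w
  proof -
    have "(g has_real_derivative std_normal_density w +
       ((std_normal_density w + w * (- w * std_normal_density w)) * (1 + w\<^sup>2)
         - w * std_normal_density w * (2 * w)) / ((1 + w\<^sup>2) * (1 + w\<^sup>2))) (at w)"
      unfolding g_def using nz[of w]
      by (auto intro!: derivative_eq_intros)
    also have "std_normal_density w +
       ((std_normal_density w + w * (- w * std_normal_density w)) * (1 + w\<^sup>2)
         - w * std_normal_density w * (2 * w)) / ((1 + w\<^sup>2) * (1 + w\<^sup>2))
        = std_normal_density w * (2 / (1 + w\<^sup>2)\<^sup>2)"
      using nz[of w] by (simp add: divide_simps) (simp add: algebra_simps power2_eq_square)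
    finally show ?thesis .
  qed
  moreover have "std_normal_density w * (2 / (1 + w\<^sup>2)\<^sup>2) > 0" for w
    using nz[of w] std_normal_density_gt_0[of w] by simp
  moreover have "(g \<longlongrightarrow> 0) at_bot"
  proof -
    have "((\<lambda>w::real. w * ((1 / sqrt (2 * pi)) * exp (- w\<^sup>2 / 2)) / (1 + w\<^sup>2)) \<longlongrightarrow> 0) at_bot"
      by real_asymp
    from tendsto_add[OF std_normal_cdf_lims(1) this] show ?thesis
      by (simp add: g_def std_normal_density_def)
  qed
  ultimately have "0 < g x"
    by (intro DERIV_pos_imp_increasing_at_bot[of x g]) blast+
  moreover have "1 + x\<^sup>2 > 0" by (simp add: add_pos_nonneg)
  ultimately show ?thesis by (simp add: g_def field_simps)
qed

lemma mills_upper: "- x * std_normal_cdf x \<le> std_normal_density x"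
proof (cases "x < 0")
  case True
  \<comment> \<open>For negative arguments this difference again increases from the limit 0 at minus
    infinity.\<close>
  define g where "g = (\<lambda>w. std_normal_density w / (- w) - std_normal_cdf w)"
  have "(g has_real_derivative std_normal_density w / w\<^sup>2) (at w)" if "w \<le> x" for w
  proof -
    have "w < 0" using that True by simp
    then have "(g has_real_derivative ((- w * std_normal_density w) * (- w) - std_normal_density w * (- 1))
         / ((- w) * (- w)) - std_normal_density w) (at w)"
      unfolding g_def using \<open>w < 0\<close>
      by (intro DERIV_diff DERIV_divide DERIV_minus DERIV_ident std_normal_density_has_derivative
            std_normal_cdf_has_derivative) simp
    also have "((- w * std_normal_density w) * (- w) - std_normal_density w * (- 1)) / ((- w) * (- w))
        - std_normal_density w = std_normal_density w / w\<^sup>2"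
      using \<open>w < 0\<close> by (simp add: divide_simps) (simp add: algebra_simps power2_eq_square)
    finally show ?thesis .
  qed
  moreover have "std_normal_density w / w\<^sup>2 > 0" if "w \<le> x" for w
    using that True std_normal_density_gt_0[of w] by simp
  moreover have "(g \<longlongrightarrow> 0) at_bot"
  proof -
    have "((\<lambda>w::real. ((1 / sqrt (2 * pi)) * exp (- w\<^sup>2 / 2)) / (- w)) \<longlongrightarrow> 0) at_bot"
      by real_asymp
    from tendsto_diff[OF this std_normal_cdf_lims(1)] show ?thesis
      by (simp add: g_def std_normal_density_def)
  qed
  ultimately have "0 < g x"
    by (intro DERIV_pos_imp_increasing_at_bot[of x g]) blast+
  then show ?thesis using True by (simp add: g_def field_simps)
next
  case False
  then have "- x * std_normal_cdf x \<le> 0" using std_normal_cdf_bounds(1)[of x]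
    by (simp add: mult_nonneg_nonneg)
  also have "0 \<le> std_normal_density x" by simp
  finally show ?thesis .
qed

definition mills :: "real \<Rightarrow> real" where
  "mills x = std_normal_cdf x / std_normal_density x"

text \<open>Hence \<open>k * mills\<close> solves \<open>f' - w f = k\<close> for constant
  \<open>k\<close>; the solution of Stein's equation is glued from two such pieces.\<close>

lemma mills_has_derivative [derivative_intros]:
  "(mills has_real_derivative x * mills x + 1) (at x)"
proof -
  have "(mills has_real_derivative (std_normal_density x * std_normal_density x
     - std_normal_cdf x * (- x * std_normal_density x)) / (std_normal_density x * std_normal_density x)) (at x)"
    unfolding mills_def using std_normal_density_gt_0[of x]
    by (auto intro!: derivative_eq_intros)
  also have "(std_normal_density x * std_normal_density x - std_normal_cdf x * (- x * std_normal_density x))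
     / (std_normal_density x * std_normal_density x) = x * mills x + 1"
    using std_normal_density_gt_0[of x] by (simp add: mills_def field_simps)
  finally show ?thesis .
qed

lemma mills_pos: "0 < mills x"
  by (simp add: mills_def std_normal_cdf_pos std_normal_density_gt_0)

lemma mult_mills_ge: "- 1 \<le> x * mills x"
  using mills_upper[of x] std_normal_density_gt_0[of x] by (simp add: mills_def field_simps)

text \<open>The derivative is \<open>(1 + x^2) * mills x + x\<close>, which is nonnegative by
  \<open>mills_lower\<close>.\<close>

lemma mult_mills_mono: "x \<le> y \<Longrightarrow> x * mills x \<le> y * mills y"
proof (erule DERIV_nonneg_imp_nondecreasing)
  fix x
  have "((\<lambda>x. x * mills x) has_real_derivative mills x + x * (x * mills x + 1)) (at x)"
    by (auto intro!: derivative_eq_intros)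
  moreover have "0 \<le> mills x + x * (x * mills x + 1)"
    using mills_lower[of x] std_normal_density_gt_0[of x]
    by (simp add: mills_def field_simps power2_eq_square)
  ultimately show "\<exists>y. ((\<lambda>x. x * mills x) has_real_derivative y) (at x) \<and> 0 \<le> y" by blast
qed

section \<open>The solution of Stein's equation for the indicator of a half-line\<close>

definition stein_solution :: "real \<Rightarrow> real \<Rightarrow> real" where
  "stein_solution z w =
     (if w \<le> z then mills w * std_normal_cdf (- z) else mills (- w) * std_normal_cdf z)"

text \<open>Defined by Stein's equation itself, so that the equation holds for every
  \<open>w\<close>. At the kink \<open>w = z\<close> the value is the left derivative.\<close>

definition stein_deriv :: "real \<Rightarrow> real \<Rightarrow> real" where
  "stein_deriv z w = w * stein_solution z w + of_bool (w \<le> z) - std_normal_cdf z"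

text \<open>For positive \<open>z\<close> use \<open>mills_upper\<close> at \<open>- z\<close> and
  bound \<open>std_normal_cdf z\<close> by 1; otherwise the left side is nonpositive.\<close>

lemma mult_stein_solution_at: "z * (mills z * std_normal_cdf (- z)) \<le> 1"
proof (cases "z \<le> 0")
  case True
  then show ?thesis
    using mills_pos[of z] std_normal_cdf_pos[of "- z"]
    by (smt (verit) mult_nonneg_nonneg mult_nonpos_nonneg)
next
  case False
  have "z * std_normal_cdf (- z) \<le> std_normal_density z"
    using mills_upper[of "- z"] by (simp add: std_normal_density_def)
  then have "std_normal_cdf z * (z * std_normal_cdf (- z)) \<le> 1 * std_normal_density z"
    using False std_normal_cdf_bounds[of z] std_normal_cdf_bounds[of "- z"]
    by (intro mult_mono) auto
  then show ?thesis
    using std_normal_density_gt_0[of z] by (simp add: mills_def field_simps)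
qed

text \<open>On each side of \<open>z\<close> the function is a nonnegative multiple of
  \<open>x * mills x\<close> or of its odd reflection, and the two formulas agree at
  \<open>z\<close>.\<close>

lemma mult_stein_solution_mono:
  assumes "x \<le> y"
  shows "x * stein_solution z x \<le> y * stein_solution z y"
proof -
  have le: "a * (mills a * std_normal_cdf (- z)) \<le> b * (mills b * std_normal_cdf (- z))" if "a \<le> b" for a b
    using mult_right_mono[OF mult_mills_mono[OF that] std_normal_cdf_bounds(1)[of "- z"]]
    by (simp add: mult.assoc)
  have ge: "a * (mills (- a) * std_normal_cdf z) \<le> b * (mills (- b) * std_normal_cdf z)" if "a \<le> b" for a b
    using mult_right_mono[OF mult_mills_mono[of "- b" "- a"] std_normal_cdf_bounds(1)[of z]] that
    by (simp add: mult.assoc)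
  have eq: "mills z * std_normal_cdf (- z) = mills (- z) * std_normal_cdf z"
    by (simp add: mills_def std_normal_density_def)
  show ?thesis
    using assms le[of x y] ge[of x y] le[of x z] ge[of z y] eq
    by (auto simp: stein_solution_def split: if_splits)
qed

text \<open>On each side one bound comes from \<open>mult_mills_ge\<close>, the other from
  monotonicity and the value at \<open>z\<close>.\<close>

lemma mult_stein_solution_bound: "\<bar>w * stein_solution z w\<bar> \<le> 1"
proof -
  have eq: "mills z * std_normal_cdf (- z) = mills (- z) * std_normal_cdf z"
    by (simp add: mills_def std_normal_density_def)
  have z: "z * stein_solution z z \<le> 1"
    using mult_stein_solution_at[of z] by (simp add: stein_solution_def)
  have z': "- 1 \<le> z * stein_solution z z"
    using mult_stein_solution_at[of "- z"] eq by (simp add: stein_solution_def)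
  have prod: "- 1 \<le> m * t" if "- 1 \<le> m" "0 \<le> t" "t \<le> 1" for m t :: real
  proof -
    have "- t \<le> m * t" using mult_right_mono[OF that(1,2)] by simp
    then show ?thesis using that by simp
  qed
  show ?thesis
  proof (cases "w \<le> z")
    case True
    then show ?thesis
      using prod[OF mult_mills_ge[of w] std_normal_cdf_bounds[of "- z"]]
        mult_stein_solution_mono[OF True, of z] z
      by (simp add: stein_solution_def mult.assoc)
  next
    case False
    then show ?thesis
      using prod[OF mult_mills_ge[of "- w"] std_normal_cdf_bounds[of z]]
        mult_stein_solution_mono[of z w z] z'
      by (simp add: stein_solution_def mult.assoc)
  qed
qed

lemma stein_deriv_bound: "\<bar>stein_deriv z w\<bar> \<le> 2"
  using mult_stein_solution_bound[of w z] std_normal_cdf_bounds[of z]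
  by (auto simp: stein_deriv_def abs_le_iff of_bool_def)

lemma stein_solution_has_derivative:
  assumes "w \<noteq> z"
  shows "(stein_solution z has_real_derivative stein_deriv z w) (at w)"
proof (cases "w < z")
  case True
  have "((\<lambda>w. mills w * std_normal_cdf (- z)) has_real_derivative
      (w * mills w + 1) * std_normal_cdf (- z)) (at w)"
    by (auto intro!: derivative_eq_intros)
  also have "(w * mills w + 1) * std_normal_cdf (- z) = stein_deriv z w"
    using True by (simp add: stein_deriv_def stein_solution_def std_normal_cdf_minus algebra_simps)
  finally show ?thesis
    by (rule has_field_derivative_transform_within_open[of _ _ _ "{..<z}"])
       (use True in \<open>auto simp: stein_solution_def\<close>)
next
  case False
  have "((\<lambda>w. mills (- w) * std_normal_cdf z) has_real_derivative
      (- (- w * mills (- w) + 1)) * std_normal_cdf z) (at w)"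
    by (auto intro!: derivative_eq_intros DERIV_chain2[of mills])
  also have "(- (- w * mills (- w) + 1)) * std_normal_cdf z = stein_deriv z w"
    using False assms by (simp add: stein_deriv_def stein_solution_def algebra_simps)
  finally show ?thesis
    by (rule has_field_derivative_transform_within_open[of _ _ _ "{z<..}"])
       (use False assms in \<open>auto simp: stein_solution_def\<close>)
qed

lemma isCont_stein_solution: "isCont (stein_solution z) w"
proof (cases "w = z")
  case True
  have "((\<lambda>w. mills w * std_normal_cdf (- z)) has_real_derivative
      (x * mills x + 1) * std_normal_cdf (- z)) (at x)"
    and "((\<lambda>w. mills (- w) * std_normal_cdf z) has_real_derivative
      (- (- x * mills (- x) + 1)) * std_normal_cdf z) (at x)" for x
    by (auto intro!: derivative_eq_intros DERIV_chain2[of mills])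
  then have "continuous_on A (\<lambda>x. mills x * std_normal_cdf (- z))"
    and "continuous_on A (\<lambda>x. mills (- x) * std_normal_cdf z)" for A
    by (meson DERIV_isCont continuous_at_imp_continuous_on)+
  then have "continuous_on ({..z} \<union> {z..}) (\<lambda>w. if w \<le> z then mills w * std_normal_cdf (- z)
       else mills (- w) * std_normal_cdf z)"
    by (intro continuous_on_If) (auto simp: mills_def std_normal_density_def)
  moreover have "{..z} \<union> {z..} = UNIV" by auto
  ultimately have "continuous_on UNIV (stein_solution z)"
    by (simp add: stein_solution_def[abs_def])
  then show ?thesis
    by (simp add: continuous_on_eq_continuous_at)
next
  case False
  show ?thesis by (rule DERIV_isCont) (rule stein_solution_has_derivative[OF False])
qed

text \<open>The nondecreasing function whose increments control the error in Stein's equation.\<close>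

definition stein_majorant :: "real \<Rightarrow> real \<Rightarrow> real" where
  "stein_majorant z w = w * stein_solution z w + of_bool (w > z)"

lemma stein_majorant_bound: "\<bar>stein_majorant z w\<bar> \<le> 2"
  using mult_stein_solution_bound[of w z] by (auto simp: stein_majorant_def abs_le_iff of_bool_def)

text \<open>The derivative at \<open>w\<close> and the difference quotient over the interval both
  lie between \<open>lo\<close> and \<open>hi\<close>, whose gap is the increment of
  \<open>stein_majorant\<close>.\<close>

lemma stein_increment:
  assumes "a \<le> b" "a \<le> w" "w \<le> b"
  shows "\<bar>stein_deriv z w * (b - a) - (stein_solution z b - stein_solution z a)\<bar>
     \<le> (b - a) * (stein_majorant z b - stein_majorant z a)"
proof (cases "a = b")
  case False
  then have ab: "a < b" using assms by simp
  define lo where "lo = a * stein_solution z a + of_bool (b \<le> z) - std_normal_cdf z"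
  define hi where "hi = b * stein_solution z b + of_bool (a \<le> z) - std_normal_cdf z"
  have d: "lo \<le> stein_deriv z x \<and> stein_deriv z x \<le> hi" if "a \<le> x" "x \<le> b" for x
    using mult_stein_solution_mono[OF that(1), of z] mult_stein_solution_mono[OF that(2), of z] that
    by (auto simp: lo_def hi_def stein_deriv_def of_bool_def)
  have piece: "lo * (y - x) \<le> stein_solution z y - stein_solution z x \<and>
      stein_solution z y - stein_solution z x \<le> hi * (y - x)"
    if xy: "a \<le> x" "x \<le> y" "y \<le> b" "y \<le> z \<or> z \<le> x" for x y
  proof (cases "x = y")
    case False
    then have "x < y" using xy by simp
    have "continuous_on {x..y} (stein_solution z)"
      using isCont_stein_solution continuous_at_imp_continuous_on by blast
    moreover have "stein_solution z differentiable (at t)" if "x < t" "t < y" for t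
      using stein_solution_has_derivative[of t z] xy(4) that real_differentiable_def by auto
    ultimately obtain l u where u: "x < u" "u < y" "(stein_solution z has_real_derivative l) (at u)"
      "stein_solution z y - stein_solution z x = (y - x) * l"
      using MVT[OF \<open>x < y\<close>, of "stein_solution z"] by blast
    have "l = stein_deriv z u"
      using u xy(4) stein_solution_has_derivative[of u z] DERIV_unique by fastforce
    then show ?thesis
      using u d[of u] xy \<open>x < y\<close> by (simp add: mult.commute mult_left_mono)
  qed simp
  have "lo * (b - a) \<le> stein_solution z b - stein_solution z a \<and>
      stein_solution z b - stein_solution z a \<le> hi * (b - a)"
  \<comment> \<open>The mean value theorem needs differentiability in the interior, so an interval
    that contains the kink inside is cut there.\<close>
  proof (cases "b \<le> z \<or> z \<le> a")
    case True
    then show ?thesis using piece[of a b] ab by simp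
  next
    case False
    then show ?thesis using piece[of a z] piece[of z b] by (simp add: algebra_simps)
  qed
  moreover have "lo * (b - a) \<le> stein_deriv z w * (b - a) \<and> stein_deriv z w * (b - a) \<le> hi * (b - a)"
    using d[of w] assms ab by (simp add: mult_right_mono)
  moreover have "hi - lo = stein_majorant z b - stein_majorant z a"
    by (auto simp: hi_def lo_def stein_majorant_def of_bool_def)
  then have "(b - a) * (stein_majorant z b - stein_majorant z a) = hi * (b - a) - lo * (b - a)"
    by (metis left_diff_distrib mult.commute)
  ultimately show ?thesis by (auto simp: abs_le_iff)
qed simp

section \<open>Monotone polynomials of a random subset\<close>

text \<open>The indicator is the product of the coordinates in \<open>A\<close>, hence a squarefree
  monomial in the edge variables.\<close>

definition monomial :: "'e set \<Rightarrow> 'e set \<Rightarrow> real" where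
  "monomial A H = of_bool (A \<subseteq> H)"

lemma monomial_mult: "monomial A H * monomial B H = monomial (A \<union> B) H"
  by (simp add: monomial_def)

lemma monomial_nonneg: "0 \<le> monomial A H"
  by (simp add: monomial_def)

lemma monomial_insert: "e \<notin> A \<Longrightarrow> monomial A (insert e H) = monomial A H"
  by (auto simp: monomial_def of_bool_def)

lemma monomial_increment:
  "monomial A (insert e H) - monomial A (H - {e}) = (if e \<in> A then monomial (A - {e}) H else 0)"
  by (auto simp: monomial_def of_bool_def)

text \<open>Bernoulli's inequality; it extracts the factor \<open>1 - p\<close> that keeps the final
  rate sharp for \<open>p\<close> near 1.\<close>

lemma one_minus_power_le: "0 \<le> p \<Longrightarrow> p \<le> 1 \<Longrightarrow> 1 - p ^ m \<le> real m * (1 - p)" for p :: real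
  using Bernoulli_inequality[of "p - 1" m] by (simp add: algebra_simps)

section \<open>Expectations over a Bernoulli subset and integration by parts\<close>

locale random_subset =
  fixes D :: "'e set" and p :: real
  assumes finite_D: "finite D" and p_pos: "0 < p" and p_less_1: "p < 1"
begin

definition weight :: "'e set \<Rightarrow> real" where
  "weight H = p ^ card H * (1 - p) ^ card (D - H)"

text \<open>A finite sum, so that no measurability or integrability arises; it is identified with
  the expectation under the random graph law in \<open>expectation_bernoulli_subset\<close>.\<close>

definition ex :: "('e set \<Rightarrow> real) \<Rightarrow> real" where
  "ex g = (\<Sum>H\<in>Pow D. weight H * g H)"

lemma weight_nonneg: "0 \<le> weight H"
  using p_pos p_less_1 by (simp add: weight_def)

lemma ex_add: "ex (\<lambda>H. f H + g H) = ex f + ex g"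
  by (simp add: ex_def distrib_left sum.distrib)

lemma ex_diff: "ex (\<lambda>H. f H - g H) = ex f - ex g"
  by (simp add: ex_def right_diff_distrib sum_subtractf)

lemma ex_cmult: "ex (\<lambda>H. c * f H) = c * ex f"
  by (simp add: ex_def sum_distrib_left mult.left_commute)

lemma ex_sum: "ex (\<lambda>H. \<Sum>i\<in>I. f i H) = (\<Sum>i\<in>I. ex (f i))"
  by (simp add: ex_def sum_distrib_left) (rule sum.swap)

lemma ex_mono: "(\<And>H. H \<subseteq> D \<Longrightarrow> f H \<le> g H) \<Longrightarrow> ex f \<le> ex g"
  unfolding ex_def by (intro sum_mono mult_left_mono weight_nonneg) auto

lemma ex_nonneg: "(\<And>H. H \<subseteq> D \<Longrightarrow> 0 \<le> g H) \<Longrightarrow> 0 \<le> ex g"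
  unfolding ex_def by (intro sum_nonneg mult_nonneg_nonneg weight_nonneg) auto

lemma ex_abs: "\<bar>ex f\<bar> \<le> ex (\<lambda>H. \<bar>f H\<bar>)"
  unfolding ex_def using sum_abs[of "\<lambda>H. weight H * f H" "Pow D"]
  by (simp add: abs_mult abs_of_nonneg[OF weight_nonneg])

text \<open>Conditioning on the coordinate \<open>e\<close>: the subsets of \<open>D\<close> pair up
  as \<open>H\<close> and \<open>insert e H\<close>, with weights in proportion \<open>1 - p\<close>
  to \<open>p\<close>.\<close>

lemma ex_split:
  assumes "e \<in> D"
  shows "ex g = p * ex (\<lambda>H. g (insert e H)) + (1 - p) * ex (\<lambda>H. g (H - {e}))"
proof -
  define F where "F = D - {e}"
  have F: "D = insert e F" "e \<notin> F" "finite F" using assms finite_D by (auto simp: F_def)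
  have split: "ex h = (\<Sum>H\<in>Pow F. p ^ card H * (1 - p) ^ card (F - H) * (p * h (insert e H) + (1 - p) * h H))"
    for h
  proof -
    have "Pow D = Pow F \<union> insert e ` Pow F"
      unfolding F(1) by (rule Pow_insert)
    then have "ex h = (\<Sum>H\<in>Pow F. weight H * h H) + (\<Sum>H\<in>insert e ` Pow F. weight H * h H)"
      unfolding ex_def using F(2,3) by (simp only:) (rule sum.union_disjoint, auto)
    also have "(\<Sum>H\<in>insert e ` Pow F. weight H * h H) = (\<Sum>H\<in>Pow F. weight (insert e H) * h (insert e H))"
      using F(2) by (subst sum.reindex) (auto simp: inj_on_def)
    also have "(\<Sum>H\<in>Pow F. weight H * h H) + \<dots>
        = (\<Sum>H\<in>Pow F. p ^ card H * (1 - p) ^ card (F - H) * (p * h (insert e H) + (1 - p) * h H))"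
      unfolding sum.distrib[symmetric]
    proof (rule sum.cong)
      fix H assume "H \<in> Pow F"
      then have H: "H \<subseteq> F" "finite H" "e \<notin> H" using F finite_subset by auto
      have "D - H = insert e (F - H)" "D - insert e H = F - H" using F H by auto
      moreover have "card (insert e (F - H)) = Suc (card (F - H))" using F H by simp
      ultimately show "weight H * h H + weight (insert e H) * h (insert e H)
         = p ^ card H * (1 - p) ^ card (F - H) * (p * h (insert e H) + (1 - p) * h H)"
        using H by (simp add: weight_def algebra_simps)
    qed simp
    finally show ?thesis .
  qed
  have 1: "ex (\<lambda>H. g (insert e H)) = (\<Sum>H\<in>Pow F. p ^ card H * (1 - p) ^ card (F - H) * g (insert e H))"
    unfolding split by (intro sum.cong) (auto simp: algebra_simps)
  have 2: "ex (\<lambda>H. g (H - {e})) = (\<Sum>H\<in>Pow F. p ^ card H * (1 - p) ^ card (F - H) * g H)"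
    unfolding split
  proof (intro sum.cong)
    fix H assume "H \<in> Pow F"
    then have "H - {e} = H" using F(2) by auto
    then show "p ^ card H * (1 - p) ^ card (F - H) * (p * g (insert e H - {e}) + (1 - p) * g (H - {e}))
        = p ^ card H * (1 - p) ^ card (F - H) * g H"
      by (simp add: algebra_simps)
  qed simp
  show ?thesis
    unfolding 1 2 by (subst split) (simp only: distrib_left sum.distrib sum_distrib_left mult_ac)
qed

lemma ex_monomial:
  assumes "A \<subseteq> D"
  shows "ex (monomial A) = p ^ card A"
proof -
  have "finite A" using assms finite_D finite_subset by blast
  from this assms show ?thesis
  proof (induction A)
    case empty
    \<comment> \<open>Expanding the product of \<open>p + (1 - p)\<close> over \<open>D\<close>
      gives one term, namely the weight, for each subset.\<close>
    have "ex (\<lambda>_. 1) = (p + (1 - p)) ^ card D"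
      using prod_add[OF finite_D, of "\<lambda>_. p" "\<lambda>_. 1 - p"] by (simp add: ex_def weight_def)
    then show ?case by (simp add: monomial_def[abs_def])
  next
    case (insert e A)
    have "monomial (insert e A) (insert e H) = monomial A H" for H
      using insert by (auto simp: monomial_def of_bool_def)
    moreover have "monomial (insert e A) (H - {e}) = 0" for H
      by (auto simp: monomial_def)
    ultimately have "ex (monomial (insert e A)) = p * ex (monomial A) + (1 - p) * ex (\<lambda>_. 0)"
      using insert by (subst ex_split[of e]) auto
    also have "ex (\<lambda>_. 0) = 0" by (simp add: ex_def)
    finally show ?case using insert by simp
  qed
qed

lemma ex_const: "ex (\<lambda>_. c) = c"
proof -
  have "ex (\<lambda>_. 1) = 1"
    using ex_monomial[of "{}"] by (simp add: monomial_def[abs_def])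
  then show ?thesis using ex_cmult[of c "\<lambda>_. 1"] by simp
qed

text \<open>Nonnegativity of the variance of \<open>\<bar>f\<bar>\<close>.\<close>

lemma ex_abs_le_sqrt: "ex (\<lambda>H. \<bar>f H\<bar>) \<le> sqrt (ex (\<lambda>H. (f H)\<^sup>2))"
proof -
  define m where "m = ex (\<lambda>H. \<bar>f H\<bar>)"
  have "0 \<le> ex (\<lambda>H. (\<bar>f H\<bar> - m)\<^sup>2)" by (rule ex_nonneg) simp
  also have "(\<lambda>H. (\<bar>f H\<bar> - m)\<^sup>2) = (\<lambda>H. (f H)\<^sup>2 - (2 * m) * \<bar>f H\<bar> + m\<^sup>2)"
    by (auto simp: power2_diff)
  also have "ex \<dots> = ex (\<lambda>H. (f H)\<^sup>2) - m\<^sup>2"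
    by (simp only: ex_add ex_diff ex_cmult ex_const m_def[symmetric]) (simp add: power2_eq_square)
  finally have "m\<^sup>2 \<le> ex (\<lambda>H. (f H)\<^sup>2)" by simp
  then show ?thesis unfolding m_def by (rule real_le_rsqrt)
qed

text \<open>Given the other coordinates, the centred variable is \<open>1 - p\<close> with
  probability \<open>p\<close> and \<open>- p\<close> with probability \<open>1 - p\<close>, while
  \<open>v\<close> stays fixed.\<close>

lemma ex_by_parts:
  assumes e: "e \<in> D" and free: "\<And>H. v (insert e H) = v H"
  shows "ex (\<lambda>H. (monomial {e} H - p) * (v H * g H))
     = p * (1 - p) * ex (\<lambda>H. v H * (g (insert e H) - g (H - {e})))"
proof -
  have free': "v (H - {e}) = v H" for H
  proof (cases "e \<in> H")
    case True
    then show ?thesis using free[of "H - {e}"] by (simp add: insert_absorb)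
  qed simp
  have "ex (\<lambda>H. (monomial {e} H - p) * (v H * g H))
     = p * ex (\<lambda>H. (1 - p) * (v H * g (insert e H))) + (1 - p) * ex (\<lambda>H. (- p) * (v H * g (H - {e})))"
    by (subst ex_split[OF e]) (simp add: free free' monomial_def)
  also have "\<dots> = p * (1 - p) * (ex (\<lambda>H. v H * g (insert e H)) - ex (\<lambda>H. v H * g (H - {e})))"
    unfolding ex_cmult by (simp add: algebra_simps)
  also have "\<dots> = p * (1 - p) * ex (\<lambda>H. v H * (g (insert e H) - g (H - {e})))"
    unfolding ex_diff[symmetric] by (simp add: right_diff_distrib)
  finally show ?thesis .
qed

text \<open>Integrating by parts in \<open>e\<close> leaves an increment, which for
  \<open>e \<noteq> f\<close> vanishes unless \<open>e \<in> B\<close>; doing the same in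
  \<open>f\<close> forces \<open>f \<in> A\<close>. In that case a second factor
  \<open>1 - p\<close> appears and is bounded by 1.\<close>

lemma ex_cross_moment:
  assumes "e \<in> D" "f \<in> D" "A \<subseteq> D" "B \<subseteq> D" "e \<notin> A" "f \<notin> B"
  shows "ex (\<lambda>H. ((monomial {e} H - p) * monomial A H) * ((monomial {f} H - p) * monomial B H))
    \<le> (if e = f \<or> (e \<in> B \<and> f \<in> A) then (1 - p) * p ^ card (A \<union> B \<union> {e, f}) else 0)"
proof -
  have fin: "finite A" "finite B" using assms finite_D finite_subset by auto
  have *: "ex (\<lambda>H. ((monomial {e} H - p) * monomial A H) * ((monomial {f} H - p) * monomial B H))
    = p * (1 - p) * ex (\<lambda>H. monomial A H * ((monomial {f} (insert e H) - p) * monomial B (insert e H)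
         - (monomial {f} (H - {e}) - p) * monomial B (H - {e})))"
    unfolding mult.assoc[of "monomial {e} _ - p"]
    by (rule ex_by_parts) (use assms in \<open>auto simp: monomial_insert\<close>)
  show ?thesis
  proof (cases "e = f")
    case True
    have "(monomial {f} (insert e H) - p) * monomial B (insert e H)
         - (monomial {f} (H - {e}) - p) * monomial B (H - {e}) = monomial B H" for H
    proof -
      have "monomial B (H - {e}) = monomial B H"
        using assms True by (auto simp: monomial_def of_bool_def)
      then show ?thesis
        using assms True by (simp add: monomial_insert) (simp add: monomial_def algebra_simps)
    qed
    then have "ex (\<lambda>H. ((monomial {e} H - p) * monomial A H) * ((monomial {f} H - p) * monomial B H))
       = p * (1 - p) * ex (monomial (A \<union> B))"
      unfolding * by (simp add: monomial_mult)
    also have "\<dots> = (1 - p) * p ^ card (A \<union> B \<union> {e, f})"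
      using assms fin True by (subst ex_monomial) auto
    finally show ?thesis using True by simp
  next
    case False
    have f: "monomial {f} (insert e H) = monomial {f} H" "monomial {f} (H - {e}) = monomial {f} H" for H
      using False by (auto simp: monomial_def)
    have "monomial A H * ((monomial {f} (insert e H) - p) * monomial B (insert e H)
         - (monomial {f} (H - {e}) - p) * monomial B (H - {e}))
        = (monomial {f} H - p) * ((if e \<in> B then monomial (B - {e}) H else 0) * monomial A H)" for H
      unfolding f monomial_increment[symmetric] by (simp add: algebra_simps)
    then have "ex (\<lambda>H. ((monomial {e} H - p) * monomial A H) * ((monomial {f} H - p) * monomial B H))
       = p * (1 - p) * ex (\<lambda>H. (monomial {f} H - p) * ((if e \<in> B then monomial (B - {e}) H else 0) * monomial A H))"
      unfolding * by (simp only:)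
    also have "ex (\<lambda>H. (monomial {f} H - p) * ((if e \<in> B then monomial (B - {e}) H else 0) * monomial A H))
       = p * (1 - p) * ex (\<lambda>H. (if e \<in> B then monomial (B - {e}) H else 0) *
            (monomial A (insert f H) - monomial A (H - {f})))"
      by (rule ex_by_parts) (use assms in \<open>auto simp: monomial_insert\<close>)
    also have "\<dots> = p * (1 - p) * ex (\<lambda>H. if e \<in> B \<and> f \<in> A then monomial ((B - {e}) \<union> (A - {f})) H else 0)"
      unfolding monomial_increment by (intro arg_cong[where f = "\<lambda>g. p * (1 - p) * ex g"])
         (auto simp: monomial_mult)
    finally have eq: "ex (\<lambda>H. ((monomial {e} H - p) * monomial A H) * ((monomial {f} H - p) * monomial B H))
       = p * (1 - p) * (p * (1 - p) * ex (\<lambda>H. if e \<in> B \<and> f \<in> A then monomial ((B - {e}) \<union> (A - {f})) H else 0))" .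
    show ?thesis
    proof (cases "e \<in> B \<and> f \<in> A")
      case True
      define C where "C = (B - {e}) \<union> (A - {f})"
      have C: "e \<notin> C" "f \<notin> C" "finite C" "C \<subseteq> D" "A \<union> B \<union> {e, f} = insert e (insert f C)"
        using assms True fin by (auto simp: C_def)
      have "ex (\<lambda>H. ((monomial {e} H - p) * monomial A H) * ((monomial {f} H - p) * monomial B H))
         = p * (1 - p) * (p * (1 - p) * p ^ card C)"
        unfolding eq using True ex_monomial[OF C(4)] by (simp add: C_def)
      also have "\<dots> = (1 - p) * ((1 - p) * p ^ card (A \<union> B \<union> {e, f}))"
        unfolding C(5) using C False by simp
      also have "\<dots> \<le> 1 * ((1 - p) * p ^ card (A \<union> B \<union> {e, f}))"
        using p_pos p_less_1 by (intro mult_right_mono) auto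
      finally show ?thesis using True False by simp
    next
      case False
      then show ?thesis unfolding eq using \<open>e \<noteq> f\<close> ex_const[of 0] by auto
    qed
  qed
qed

text \<open>The covariance equals
  \<open>p ^ card (A \<union> B) * (1 - p ^ card (A \<inter> B))\<close>, to which Bernoulli's
  inequality applies.\<close>

lemma ex_monomial_covariance:
  assumes "A \<subseteq> D" "B \<subseteq> D" "card (A \<inter> B) \<le> k"
  shows "ex (\<lambda>H. (monomial A H - p ^ card A) * (monomial B H - p ^ card B))
    \<le> (if A \<inter> B \<noteq> {} then real k * (1 - p) * p ^ card (A \<union> B) else 0)"
proof -
  have fin: "finite A" "finite B" using assms finite_D finite_subset by auto
  have "(\<lambda>H. (monomial A H - p ^ card A) * (monomial B H - p ^ card B))
     = (\<lambda>H. monomial (A \<union> B) H - p ^ card B * monomial A H - p ^ card A * monomial B H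
          + p ^ card A * p ^ card B)"
    by (simp add: fun_eq_iff monomial_mult[symmetric] algebra_simps)
  then have "ex (\<lambda>H. (monomial A H - p ^ card A) * (monomial B H - p ^ card B))
     = p ^ card (A \<union> B) - p ^ card B * p ^ card A - p ^ card A * p ^ card B + p ^ card A * p ^ card B"
    using assms by (simp only: ex_add ex_diff ex_cmult ex_const) (simp add: ex_monomial)
  also have "\<dots> = p ^ card (A \<union> B) - p ^ (card A + card B)" by (simp add: power_add)
  also have "card A + card B = card (A \<union> B) + card (A \<inter> B)"
    using card_Un_Int[OF fin] .
  also have "p ^ card (A \<union> B) - p ^ (card (A \<union> B) + card (A \<inter> B))
     = p ^ card (A \<union> B) * (1 - p ^ card (A \<inter> B))"
    by (simp add: power_add algebra_simps)
  also have "\<dots> \<le> (if A \<inter> B \<noteq> {} then real k * (1 - p) * p ^ card (A \<union> B) else 0)"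
  proof (cases "A \<inter> B = {}")
    case False
    have "1 - p ^ card (A \<inter> B) \<le> real (card (A \<inter> B)) * (1 - p)"
      using p_pos p_less_1 by (intro one_minus_power_le) auto
    also have "\<dots> \<le> real k * (1 - p)"
      using assms p_less_1 by (intro mult_right_mono) auto
    finally have "p ^ card (A \<union> B) * (1 - p ^ card (A \<inter> B)) \<le> p ^ card (A \<union> B) * (real k * (1 - p))"
      using p_pos by (intro mult_left_mono) auto
    then show ?thesis using False by (simp add: mult_ac)
  qed simp
  finally show ?thesis .
qed

end

section \<open>Counting members of a set system inside a random subset\<close>

text \<open>The pairs \<open>A\<close>, \<open>B\<close> and \<open>C\<close>, \<open>G\<close> stem
  from the two factors of a second moment; the last condition is what their dependence amounts
  to.\<close>

definition linked :: "'e set \<Rightarrow> 'e set \<Rightarrow> 'e set \<Rightarrow> 'e set \<Rightarrow> bool" where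
  "linked A B C G \<longleftrightarrow> A \<inter> B \<noteq> {} \<and> C \<inter> G \<noteq> {} \<and> (A \<union> B) \<inter> (C \<union> G) \<noteq> {}"

text \<open>The family is an arbitrary collection of \<open>r\<close>-sets; the injective rank fixes
  the order in which the coordinates are revealed.\<close>

locale subset_count = random_subset D p
  for D :: "'e set" and p :: real +
  fixes T :: "'e set set" and r :: nat and rk :: "'e \<Rightarrow> nat"
  assumes members: "A \<in> T \<Longrightarrow> A \<subseteq> D" and card_member: "A \<in> T \<Longrightarrow> card A = r"
    and inj_rk: "inj_on rk D"
begin

lemma finite_T: "finite T"
  using members finite_D by (meson PowI finite_Pow_iff finite_subset subsetI)

lemma finite_member: "A \<in> T \<Longrightarrow> finite A"
  using members finite_D finite_subset by blast

definition lower :: "'e set \<Rightarrow> 'e \<Rightarrow> 'e set" where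
  "lower A e = {f \<in> A. rk f < rk e}"

definition upper :: "'e set \<Rightarrow> 'e \<Rightarrow> 'e set" where
  "upper A e = {f \<in> A. rk e < rk f}"

section \<open>The count and its discrete gradients\<close>

definition total :: "'e set \<Rightarrow> real" where
  "total H = (\<Sum>A\<in>T. monomial A H)"

definition mean :: real where
  "mean = real (card T) * p ^ r"

definition var :: real where
  "var = ex (\<lambda>H. (total H - mean)\<^sup>2)"

abbreviation containing :: "'e \<Rightarrow> 'e set set" where
  "containing e \<equiv> {A \<in> T. e \<in> A}"

definition grad :: "'e \<Rightarrow> 'e set \<Rightarrow> real" where
  "grad e H = (\<Sum>A\<in>containing e. monomial (A - {e}) H)"

text \<open>The conditional expectation of the gradient given the coordinates that precede \<open>e\<close>.\<close>

definition pgrad :: "'e \<Rightarrow> 'e set \<Rightarrow> real" where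
  "pgrad e H = (\<Sum>A\<in>containing e. p ^ card (upper A e) * monomial (lower A e) H)"

text \<open>Neither factor depends on the coordinate \<open>e\<close>, which makes
  \<open>kern e\<close> admissible as \<open>v\<close> in \<open>ex_by_parts\<close>.\<close>

definition kern :: "'e \<Rightarrow> 'e set \<Rightarrow> real" where
  "kern e H = pgrad e H * grad e H"

text \<open>The discrete counterpart of the Malliavin-Stein inner product of a gradient with a
  predictable gradient; its mean is the variance.\<close>

definition quad :: "'e set \<Rightarrow> real" where
  "quad H = p * (1 - p) * (\<Sum>e\<in>D. kern e H)"

text \<open>The adjoint of the difference operator, up to the factor \<open>p * (1 - p)\<close>,
  applied to the field \<open>kern\<close>.\<close>

definition divergence :: "'e set \<Rightarrow> real" where
  "divergence H = (\<Sum>e\<in>D. (monomial {e} H - p) * kern e H)"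

lemma total_increment: "total (insert e H) - total (H - {e}) = grad e H"
  unfolding total_def grad_def sum_subtractf[symmetric] monomial_increment
  using finite_T by (simp add: sum.inter_filter)

lemma grad_nonneg: "0 \<le> grad e H"
  unfolding grad_def by (intro sum_nonneg monomial_nonneg)

lemma pgrad_nonneg: "0 \<le> pgrad e H"
  unfolding pgrad_def using p_pos by (intro sum_nonneg mult_nonneg_nonneg monomial_nonneg) auto

lemma grad_insert: "grad e (insert e H) = grad e H"
  unfolding grad_def by (intro sum.cong) (auto simp: monomial_insert)

lemma pgrad_insert: "pgrad e (insert e H) = pgrad e H"
  unfolding pgrad_def by (intro sum.cong) (auto simp: monomial_insert lower_def)

section \<open>Martingale decomposition and covariance formula\<close>

lemma monomial_telescope:
  assumes "A \<subseteq> D"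
  shows "monomial A H - p ^ card A
    = (\<Sum>e\<in>A. (monomial {e} H - p) * (p ^ card (upper A e) * monomial (lower A e) H))"
proof -
  have "finite A" using assms finite_D finite_subset by blast
  from this assms show ?thesis
  \<comment> \<open>Elements join in order of rank. A new top element \<open>x\<close> turns
    \<open>monomial S\<close> into \<open>monomial {x} * monomial S\<close> and puts a factor
    \<open>p\<close> on all earlier terms.\<close>
  proof (induction rule: finite_ranking_induct[where f = rk])
    case empty
    then show ?case by (simp add: monomial_def)
  next
    case (insert x S)
    show ?case
    \<comment> \<open>The induction rule only yields rank at most that of \<open>x\<close>;
      strictness needs \<open>x\<close> to be new.\<close>
    proof (cases "x \<in> S")
      case True
      then show ?thesis using insert by (simp add: insert_absorb)
    next
      case False
      have less: "rk y < rk x" if "y \<in> S" for y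
        using insert.hyps(2)[OF that] insert.prems inj_rk that False
        by (metis inj_on_def insert_subset le_neq_implies_less subsetD)
      have ux: "upper (insert x S) x = {}" "lower (insert x S) x = S"
        using less by (force simp: upper_def lower_def)+
      have u: "upper (insert x S) e = insert x (upper S e)" "lower (insert x S) e = lower S e"
        "x \<notin> upper S e" "finite (upper S e)" if "e \<in> S" for e
        using less[OF that] insert.hyps(1) False by (auto simp: upper_def lower_def)
      have "(\<Sum>e\<in>S. (monomial {e} H - p) * (p ^ card (upper (insert x S) e) * monomial (lower (insert x S) e) H))
          = (\<Sum>e\<in>S. p * ((monomial {e} H - p) * (p ^ card (upper S e) * monomial (lower S e) H)))"
        by (intro sum.cong) (auto simp: u)
      also have "\<dots> = p * (monomial S H - p ^ card S)"
        using insert by (simp add: sum_distrib_left[symmetric])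
      finally have "(\<Sum>e\<in>insert x S. (monomial {e} H - p) *
           (p ^ card (upper (insert x S) e) * monomial (lower (insert x S) e) H))
         = (monomial {x} H - p) * monomial S H + p * (monomial S H - p ^ card S)"
        using insert.hyps(1) False by (simp add: ux)
      also have "monomial {x} H * monomial S H = monomial (insert x S) H"
        by (simp add: monomial_mult)
      then have "(monomial {x} H - p) * monomial S H + p * (monomial S H - p ^ card S)
          = monomial (insert x S) H - p ^ card (insert x S)"
        using insert.hyps(1) False by (simp add: algebra_simps)
      finally show ?thesis by simp
    qed
  qed
qed

lemma sum_containing:
  fixes \<phi> :: "'e \<Rightarrow> 'e set \<Rightarrow> real"
  shows "(\<Sum>e\<in>D. \<Sum>A\<in>containing e. \<phi> e A) = (\<Sum>A\<in>T. \<Sum>e\<in>A. \<phi> e A)"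
proof -
  have "(\<Sum>e\<in>D. \<Sum>A\<in>containing e. \<phi> e A) = (\<Sum>A\<in>T. \<Sum>e\<in>{e \<in> D. e \<in> A}. \<phi> e A)"
    by (rule sum.swap_restrict[OF finite_D finite_T])
  also have "\<dots> = (\<Sum>A\<in>T. \<Sum>e\<in>A. \<phi> e A)"
    using members by (intro sum.cong refl) blast
  finally show ?thesis .
qed

text \<open>The discrete Clark-Ocone formula: telescope each monomial and collect the terms by their
  marked element.\<close>

lemma total_clark_ocone: "total H - mean = (\<Sum>e\<in>D. (monomial {e} H - p) * pgrad e H)"
proof -
  have "total H - mean = (\<Sum>A\<in>T. monomial A H - p ^ card A)"
    by (simp add: total_def mean_def sum_subtractf card_member)
  also have "\<dots> = (\<Sum>A\<in>T. \<Sum>e\<in>A. (monomial {e} H - p) * (p ^ card (upper A e) * monomial (lower A e) H))"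
    by (intro sum.cong refl monomial_telescope members)
  also have "\<dots> = (\<Sum>e\<in>D. (monomial {e} H - p) * pgrad e H)"
    unfolding sum_containing[symmetric] pgrad_def by (simp add: sum_distrib_left)
  finally show ?thesis .
qed

text \<open>Each term of the decomposition is integrated by parts, \<open>pgrad e\<close> being free
  of \<open>e\<close>.\<close>

lemma covariance_formula:
  "ex (\<lambda>H. (total H - mean) * g H)
     = p * (1 - p) * (\<Sum>e\<in>D. ex (\<lambda>H. pgrad e H * (g (insert e H) - g (H - {e}))))"
proof -
  have "ex (\<lambda>H. (total H - mean) * g H)
      = (\<Sum>e\<in>D. ex (\<lambda>H. (monomial {e} H - p) * (pgrad e H * g H)))"
    unfolding total_clark_ocone sum_distrib_right ex_sum mult.assoc ..
  also have "\<dots> = (\<Sum>e\<in>D. p * (1 - p) * ex (\<lambda>H. pgrad e H * (g (insert e H) - g (H - {e}))))"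
    by (intro sum.cong refl ex_by_parts pgrad_insert)
  finally show ?thesis by (simp add: sum_distrib_left)
qed

text \<open>The covariance formula with the centred count as \<open>g\<close>, whose increments are
  \<open>grad\<close>.\<close>

lemma ex_quad: "ex quad = var"
proof -
  have "var = p * (1 - p) * (\<Sum>e\<in>D. ex (kern e))"
    unfolding var_def power2_eq_square covariance_formula
    by (intro arg_cong2[where f = times] refl sum.cong arg_cong[where f = ex])
       (simp add: fun_eq_iff kern_def total_increment[symmetric])
  also have "\<dots> = ex quad"
    unfolding quad_def[abs_def] ex_cmult ex_sum ..
  finally show ?thesis by simp
qed

section \<open>The Stein bound for the distribution of the count\<close>

theorem normal_approximation:
  assumes var_pos: "0 < var"
  shows "\<bar>ex (\<lambda>H. of_bool ((total H - mean) / sqrt var \<le> z)) - std_normal_cdf z\<bar>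
    \<le> 2 / var * (ex (\<lambda>H. \<bar>quad H - var\<bar>) + ex (\<lambda>H. \<bar>divergence H\<bar>))"
proof -
  define s where "s = sqrt var"
  have s: "0 < s" "s * s = var" using var_pos by (auto simp: s_def)
  define W where "W = (\<lambda>H. (total H - mean) / s)"
  define q where "q = p * (1 - p)"
  have q: "0 \<le> q" using p_pos p_less_1 by (simp add: q_def)
  define f where "f = stein_solution z"
  define F where "F = (\<lambda>H. stein_deriv z (W H))"
  define g where "g = (\<lambda>H. stein_majorant z (W H))"
  define df where "df = (\<lambda>e H. f (W (insert e H)) - f (W (H - {e})))"
  define dg where "dg = (\<lambda>e H. g (insert e H) - g (H - {e}))"
  \<comment> \<open>\<open>W H\<close> is one of the two endpoints \<open>W (insert e H)\<close> and
    \<open>W (H - {e})\<close>, which are ordered because \<open>grad\<close> is nonnegative, so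
    \<open>stein_increment\<close> applies.\<close>
  have step: "\<bar>F H * (grad e H / s) - df e H\<bar> \<le> grad e H / s * dg e H" for e H
  proof -
    have W: "W (insert e H) - W (H - {e}) = grad e H / s"
      by (simp add: W_def total_increment[symmetric] diff_divide_distrib)
    then have "W (H - {e}) \<le> W (insert e H)"
      using grad_nonneg[of e H] s by (smt (verit) divide_nonneg_pos)
    moreover have "H = insert e H \<or> H = H - {e}" by auto
    then have "W H = W (insert e H) \<or> W H = W (H - {e})" by metis
    ultimately show ?thesis
      using stein_increment[of "W (H - {e})" "W (insert e H)" "W H" z]
      unfolding F_def df_def dg_def f_def g_def W by auto
  qed
  have Wf: "ex (\<lambda>H. W H * f (W H)) = q / s * (\<Sum>e\<in>D. ex (\<lambda>H. pgrad e H * df e H))"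
  proof -
    have "ex (\<lambda>H. W H * f (W H)) = ex (\<lambda>H. 1 / s * ((total H - mean) * f (W H)))"
      by (simp add: W_def)
    also have "\<dots> = q / s * (\<Sum>e\<in>D. ex (\<lambda>H. pgrad e H * df e H))"
      unfolding ex_cmult covariance_formula q_def df_def by simp
    finally show ?thesis .
  qed
  have Fq: "ex (\<lambda>H. F H * (quad H / var)) = q / s * (\<Sum>e\<in>D. ex (\<lambda>H. pgrad e H * (F H * (grad e H / s))))"
  proof -
    have "(\<lambda>H. F H * (quad H / var)) = (\<lambda>H. q / s * (\<Sum>e\<in>D. pgrad e H * (F H * (grad e H / s))))"
      unfolding s(2)[symmetric]
      by (simp add: fun_eq_iff quad_def q_def kern_def sum_distrib_left sum_divide_distrib mult_ac)
    then show ?thesis by (simp only: ex_cmult ex_sum)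
  qed
  define R where "R = q / s * (\<Sum>e\<in>D. ex (\<lambda>H. pgrad e H * (F H * (grad e H / s) - df e H)))"
  have "ex (\<lambda>H. of_bool (W H \<le> z)) - std_normal_cdf z
      = ex (\<lambda>H. of_bool (W H \<le> z) - std_normal_cdf z)"
    by (simp add: ex_diff ex_const)
  \<comment> \<open>Stein's equation, valid at every point by the definition of
    \<open>stein_deriv\<close>.\<close>
  also have "\<dots> = ex (\<lambda>H. F H - W H * f (W H))"
    by (simp add: F_def stein_deriv_def f_def)
  also have "\<dots> = ex (\<lambda>H. F H * (1 - quad H / var)) + (ex (\<lambda>H. F H * (quad H / var)) - ex (\<lambda>H. W H * f (W H)))"
    unfolding ex_diff[symmetric] ex_add[symmetric] by (simp add: algebra_simps)
  also have "ex (\<lambda>H. F H * (quad H / var)) - ex (\<lambda>H. W H * f (W H)) = R"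
    unfolding Fq Wf R_def right_diff_distrib[symmetric] sum_subtractf[symmetric] ex_diff[symmetric] ..
  finally have main: "ex (\<lambda>H. of_bool (W H \<le> z)) - std_normal_cdf z = ex (\<lambda>H. F H * (1 - quad H / var)) + R" .
  have "\<bar>ex (\<lambda>H. F H * (1 - quad H / var))\<bar> \<le> ex (\<lambda>H. \<bar>F H * (1 - quad H / var)\<bar>)"
    by (rule ex_abs)
  also have "\<dots> \<le> ex (\<lambda>H. 2 / var * \<bar>quad H - var\<bar>)"
  proof (rule ex_mono)
    fix H
    have "\<bar>F H * (1 - quad H / var)\<bar> = \<bar>F H\<bar> * (\<bar>quad H - var\<bar> / var)"
    proof -
      have "1 - quad H / var = (var - quad H) / var" using var_pos by (simp add: field_simps)
      then show ?thesis using var_pos by (simp add: abs_mult abs_minus_commute)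
    qed
    also have "\<dots> \<le> 2 * (\<bar>quad H - var\<bar> / var)"
      using var_pos stein_deriv_bound[of z] by (intro mult_right_mono) (auto simp: F_def)
    finally show "\<bar>F H * (1 - quad H / var)\<bar> \<le> 2 / var * \<bar>quad H - var\<bar>" by simp
  qed
  finally have first: "\<bar>ex (\<lambda>H. F H * (1 - quad H / var))\<bar> \<le> 2 / var * ex (\<lambda>H. \<bar>quad H - var\<bar>)"
    by (simp only: ex_cmult)
  \<comment> \<open>Nonnegativity of \<open>pgrad\<close> lets the pointwise bound pass through the
    weights.\<close>
  have "\<bar>R\<bar> \<le> q / s * (\<Sum>e\<in>D. ex (\<lambda>H. pgrad e H * (grad e H / s * dg e H)))"
  proof -
    have "\<bar>\<Sum>e\<in>D. ex (\<lambda>H. pgrad e H * (F H * (grad e H / s) - df e H))\<bar>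
       \<le> (\<Sum>e\<in>D. ex (\<lambda>H. pgrad e H * (grad e H / s * dg e H)))"
    proof (rule order.trans[OF sum_abs], rule sum_mono)
      fix e
      show "\<bar>ex (\<lambda>H. pgrad e H * (F H * (grad e H / s) - df e H))\<bar>
          \<le> ex (\<lambda>H. pgrad e H * (grad e H / s * dg e H))"
        by (rule order.trans[OF ex_abs], rule ex_mono, unfold abs_mult abs_of_nonneg[OF pgrad_nonneg])
           (intro mult_left_mono step pgrad_nonneg)
    qed
    then show ?thesis
      using q s unfolding R_def by (simp add: abs_mult divide_right_mono mult_left_mono)
  qed
  also have "\<dots> = 1 / var * (\<Sum>e\<in>D. q * ex (\<lambda>H. kern e H * dg e H))"
  proof -
    have "(\<lambda>H. pgrad e H * (grad e H / s * dg e H)) = (\<lambda>H. 1 / s * (kern e H * dg e H))" for e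
      by (simp add: kern_def fun_eq_iff)
    then have "ex (\<lambda>H. pgrad e H * (grad e H / s * dg e H)) = 1 / s * ex (\<lambda>H. kern e H * dg e H)" for e
      by (simp only: ex_cmult)
    then show ?thesis unfolding s(2)[symmetric]
      by (simp add: sum_distrib_left)
  qed
  \<comment> \<open>Integration by parts read backwards: the increments of the bounded function
    \<open>g\<close> are traded for centred variables, with \<open>kern\<close> kept inside one
    signed sum.\<close>
  also have "(\<Sum>e\<in>D. q * ex (\<lambda>H. kern e H * dg e H)) = (\<Sum>e\<in>D. ex (\<lambda>H. (monomial {e} H - p) * (kern e H * g H)))"
    unfolding dg_def q_def
    by (intro sum.cong refl ex_by_parts[symmetric]) (auto simp: kern_def grad_insert pgrad_insert)
  also have "\<dots> = ex (\<lambda>H. divergence H * g H)"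
    unfolding ex_sum[symmetric] divergence_def by (simp add: sum_distrib_right mult.assoc)
  also have "\<dots> \<le> 2 * ex (\<lambda>H. \<bar>divergence H\<bar>)"
    unfolding ex_cmult[symmetric]
  proof (rule ex_mono)
    fix H
    have "divergence H * g H \<le> \<bar>divergence H\<bar> * \<bar>g H\<bar>" by (metis abs_ge_self abs_mult)
    also have "\<dots> \<le> \<bar>divergence H\<bar> * 2"
      by (intro mult_left_mono) (auto simp: g_def stein_majorant_bound)
    finally show "divergence H * g H \<le> 2 * \<bar>divergence H\<bar>" by simp
  qed
  finally have second: "\<bar>R\<bar> \<le> 2 / var * ex (\<lambda>H. \<bar>divergence H\<bar>)"
    using var_pos by (simp add: divide_right_mono)
  show ?thesis
    using first second main unfolding W_def s_def by (simp add: distrib_left)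
qed

section \<open>Second moments of \<open>quad\<close> and \<open>divergence\<close>\<close>

definition flags :: "('e \<times> 'e set \<times> 'e set) set" where
  "flags = (SIGMA e:D. containing e \<times> containing e)"

definition links :: "('e set \<times> 'e set \<times> 'e set \<times> 'e set) set" where
  "links = {(A, B, C, G). A \<in> T \<and> B \<in> T \<and> C \<in> T \<and> G \<in> T \<and> linked A B C G}"

text \<open>Each summand is the probability that the random subset contains all four
  members.\<close>

definition link_weight :: real where
  "link_weight = (\<Sum>(A, B, C, G)\<in>links. p ^ card (A \<union> B \<union> C \<union> G))"

text \<open>A flag \<open>(e, A, B)\<close> indexes one term of the expanded \<open>kern e\<close>:
  \<open>A\<close> comes from \<open>pgrad\<close>, \<open>B\<close> from
  \<open>grad\<close>.\<close>

fun flag_coeff :: "'e \<times> 'e set \<times> 'e set \<Rightarrow> real" where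
  "flag_coeff (e, A, B) = p ^ card (upper A e)"

fun flag_set :: "'e \<times> 'e set \<times> 'e set \<Rightarrow> 'e set" where
  "flag_set (e, A, B) = lower A e \<union> (B - {e})"

lemma finite_flags: "finite flags"
  unfolding flags_def using finite_D finite_T by auto

lemma finite_links: "finite links"
  by (rule finite_subset[of _ "T \<times> T \<times> T \<times> T"]) (use finite_T in \<open>auto simp: links_def\<close>)

lemma mem_flags_iff: "(e, A, B) \<in> flags \<longleftrightarrow> A \<in> T \<and> B \<in> T \<and> e \<in> A \<and> e \<in> B"
  using members by (auto simp: flags_def)

lemma flagsD:
  assumes "(e, A, B) \<in> flags"
  shows "e \<in> D" "A \<in> T" "B \<in> T" "e \<in> A" "e \<in> B" "finite A" "finite B" "A \<subseteq> D" "B \<subseteq> D"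
  using assms finite_member members by (auto simp: flags_def)

lemma flag_set_props:
  assumes "x \<in> flags"
  shows "flag_set x \<subseteq> D" "fst x \<notin> flag_set x" "card (flag_set x) \<le> 2 * r" "finite (flag_set x)"
proof -
  obtain e A B where x: "x = (e, A, B)" by (cases x)
  note f = flagsD[OF assms[unfolded x]]
  show "flag_set x \<subseteq> D" "fst x \<notin> flag_set x" "finite (flag_set x)"
    using f by (auto simp: x lower_def)
  have "card (flag_set x) \<le> card (lower A e) + card (B - {e})"
    by (simp add: x card_Un_le)
  also have "\<dots> \<le> card A + card B"
    using f by (intro add_mono card_mono) (auto simp: lower_def)
  finally show "card (flag_set x) \<le> 2 * r" using f by (simp add: card_member)
qed

lemma kern_expand:
  "kern e H = (\<Sum>y\<in>containing e \<times> containing e. flag_coeff (e, y) * monomial (flag_set (e, y)) H)"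
  unfolding kern_def pgrad_def grad_def sum_product sum.cartesian_product
  by (intro sum.cong refl) (auto simp: monomial_mult[symmetric])

lemma sum_flags: "(\<Sum>e\<in>D. \<Sum>y\<in>containing e \<times> containing e. h (e, y)) = (\<Sum>x\<in>flags. h x)"
  unfolding flags_def using finite_D finite_T by (subst sum.Sigma) auto

lemma quad_expand: "quad H = (\<Sum>x\<in>flags. p * (1 - p) * flag_coeff x * monomial (flag_set x) H)"
proof -
  have "quad H = (\<Sum>e\<in>D. \<Sum>y\<in>containing e \<times> containing e.
      p * (1 - p) * flag_coeff (e, y) * monomial (flag_set (e, y)) H)"
    unfolding quad_def kern_expand by (simp add: sum_distrib_left mult.assoc)
  also have "\<dots> = (\<Sum>x\<in>flags. p * (1 - p) * flag_coeff x * monomial (flag_set x) H)"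
    by (rule sum_flags[where h = "\<lambda>x. p * (1 - p) * flag_coeff x * monomial (flag_set x) H"])
  finally show ?thesis .
qed

lemma divergence_expand:
  "divergence H = (\<Sum>x\<in>flags. flag_coeff x * ((monomial {fst x} H - p) * monomial (flag_set x) H))"
proof -
  have "divergence H = (\<Sum>e\<in>D. \<Sum>y\<in>containing e \<times> containing e.
      flag_coeff (e, y) * ((monomial {fst (e, y)} H - p) * monomial (flag_set (e, y)) H))"
    unfolding divergence_def kern_expand
    by (simp add: sum_distrib_left mult.left_commute)
  also have "\<dots> = (\<Sum>x\<in>flags. flag_coeff x * ((monomial {fst x} H - p) * monomial (flag_set x) H))"
    by (rule sum_flags[where h =
          "\<lambda>x. flag_coeff x * ((monomial {fst x} H - p) * monomial (flag_set x) H)"])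
  finally show ?thesis .
qed

definition flag_pair_weight :: "'e \<times> 'e set \<times> 'e set \<Rightarrow> 'e \<times> 'e set \<times> 'e set \<Rightarrow> real" where
  "flag_pair_weight x y = (case (x, y) of ((e, A, B), (f, C, G)) \<Rightarrow>
     if linked A B C G then p ^ card (A \<union> B \<union> C \<union> G) else 0)"

lemma flag_pair_weight_nonneg: "0 \<le> flag_pair_weight x y"
  using p_pos by (auto simp: flag_pair_weight_def split: prod.splits)

text \<open>Forgetting the marks \<open>e \<in> A\<close> and \<open>f \<in> C\<close> is at most
  \<open>r^2\<close>-to-one onto linked quadruples.\<close>

lemma sum_flag_pair_weight:
  "(\<Sum>x\<in>flags. \<Sum>y\<in>flags. flag_pair_weight x y) \<le> (real r)\<^sup>2 * link_weight"
proof -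
  define S where "S = {z \<in> flags \<times> flags. case z of ((e, A, B), (f, C, G)) \<Rightarrow> linked A B C G}"
  define h where "h = (\<lambda>((e :: 'e, A :: 'e set, B :: 'e set), (f :: 'e, C :: 'e set, G :: 'e set)). (A, B, C, G))"
  define w where "w = (\<lambda>(A, B, C, G). p ^ card (A \<union> B \<union> C \<union> G :: 'e set))"
  have w: "0 \<le> w Q" for Q using p_pos by (auto simp: w_def split: prod.splits)
  have finS: "finite S" using finite_flags by (simp add: S_def)
  have "(\<Sum>x\<in>flags. \<Sum>y\<in>flags. flag_pair_weight x y) = (\<Sum>z\<in>flags \<times> flags. flag_pair_weight (fst z) (snd z))"
    by (simp add: sum.cartesian_product case_prod_unfold)
  also have "\<dots> = (\<Sum>z\<in>S. w (h z))"
    unfolding S_def using finite_flags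
    by (simp add: sum.inter_filter) (auto intro!: sum.cong simp: flag_pair_weight_def h_def w_def)
  also have "\<dots> = (\<Sum>Q\<in>h ` S. \<Sum>z\<in>{z \<in> S. h z = Q}. w (h z))"
    by (rule sum.image_gen[OF finS])
  also have "\<dots> = (\<Sum>Q\<in>h ` S. real (card {z \<in> S. h z = Q}) * w Q)"
    by (intro sum.cong refl) simp
  also have "\<dots> \<le> (\<Sum>Q\<in>h ` S. (real r)\<^sup>2 * w Q)"
  proof (intro sum_mono mult_right_mono w)
    fix Q assume "Q \<in> h ` S"
    obtain A B C G where Q: "Q = (A, B, C, G)" by (cases Q)
    obtain e A' B' f C' G' where "((e, A', B'), (f, C', G')) \<in> S" "Q = (A', B', C', G')"
      using \<open>Q \<in> h ` S\<close> by (auto simp: h_def)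
    then have T: "A \<in> T" "C \<in> T" by (auto simp: S_def Q mem_flags_iff)
    then have T': "finite A" "finite C" by (auto intro: finite_member)
    have "{z \<in> S. h z = Q} \<subseteq> (\<lambda>(e, f). ((e, A, B), (f, C, G))) ` (A \<times> C)"
    proof
      fix z assume z: "z \<in> {z \<in> S. h z = Q}"
      obtain e A' B' f C' G' where z': "z = ((e, A', B'), (f, C', G'))" by (metis surj_pair)
      have "A' = A" "B' = B" "C' = C" "G' = G" using z by (auto simp: z' h_def Q)
      moreover have "e \<in> A'" "f \<in> C'" using z by (auto simp: z' S_def mem_flags_iff)
      ultimately show "z \<in> (\<lambda>(e, f). ((e, A, B), (f, C, G))) ` (A \<times> C)"
        unfolding z' by (intro image_eqI[of _ _ "(e, f)"]) auto
    qed
    then have "card {z \<in> S. h z = Q} \<le> card (A \<times> C)"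
      using T' by (intro surj_card_le) auto
    also have "\<dots> = r\<^sup>2" by (simp add: card_cartesian_product card_member[OF T(1)] card_member[OF T(2)] power2_eq_square)
    finally have "real (card {z \<in> S. h z = Q}) \<le> real (r\<^sup>2)" by (rule of_nat_mono)
    then show "real (card {z \<in> S. h z = Q}) \<le> (real r)\<^sup>2"
      by simp
  qed
  also have "\<dots> \<le> (\<Sum>Q\<in>links. (real r)\<^sup>2 * w Q)"
  proof (rule sum_mono2[OF finite_links])
    show "h ` S \<subseteq> links"
      by (auto simp: S_def h_def links_def mem_flags_iff)
  qed (simp add: w)
  also have "\<dots> = (real r)\<^sup>2 * link_weight"
    by (simp add: link_weight_def w_def sum_distrib_left)
  finally show ?thesis .
qed

text \<open>Each of \<open>A\<close> and \<open>C\<close> splits into the elements below, at and above the marked one.\<close>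

lemma flag_pair_power:
  assumes "x \<in> flags" "y \<in> flags"
  shows "flag_coeff x * flag_coeff y * p ^ card (flag_set x \<union> flag_set y \<union> {fst x, fst y})
    \<le> (case (x, y) of ((e, A, B), (f, C, G)) \<Rightarrow> p ^ card (A \<union> B \<union> C \<union> G))"
proof -
  obtain e A B f C G where xy: "x = (e, A, B)" "y = (f, C, G)" by (cases x, cases y)
  note fx = flagsD[OF assms(1)[unfolded xy]] and fy = flagsD[OF assms(2)[unfolded xy]]
  have split: "A \<subseteq> lower A e \<union> {e} \<union> upper A e" if "e \<in> A" "A \<subseteq> D" for A e
  proof
    fix f assume f: "f \<in> A"
    then have "rk f = rk e \<Longrightarrow> f = e" using inj_rk that by (auto dest: inj_onD)
    then show "f \<in> lower A e \<union> {e} \<union> upper A e"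
      using f by (cases "rk f" "rk e" rule: linorder_cases) (auto simp: lower_def upper_def)
  qed
  define Z where "Z = flag_set x \<union> flag_set y \<union> {fst x, fst y}"
  have "A \<union> B \<union> C \<union> G \<subseteq> upper A e \<union> (upper C f \<union> Z)"
    using split[OF fx(4,8)] split[OF fy(4,8)] by (auto simp: Z_def xy)
  moreover have "finite (upper A e \<union> (upper C f \<union> Z))"
    using fx fy flag_set_props(4)[OF assms(1)] flag_set_props(4)[OF assms(2)] by (simp add: upper_def Z_def)
  ultimately have "card (A \<union> B \<union> C \<union> G) \<le> card (upper A e \<union> (upper C f \<union> Z))"
    by (rule card_mono[rotated])
  also have "\<dots> \<le> card (upper A e) + (card (upper C f) + card Z)"
    by (meson card_Un_le add_left_mono order.trans)
  finally have "p ^ (card (upper A e) + (card (upper C f) + card Z)) \<le> p ^ card (A \<union> B \<union> C \<union> G)"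
    using p_pos p_less_1 by (intro power_decreasing) auto
  then show ?thesis
    by (simp add: xy Z_def[unfolded xy] power_add mult.assoc)
qed

text \<open>Common frame for both second moments: only the contribution of a single pair of flags
  has to be estimated.\<close>

lemma second_moment_flags:
  assumes "\<And>x y. x \<in> flags \<Longrightarrow> y \<in> flags \<Longrightarrow> ex (\<lambda>H. h x H * h y H) \<le> K * flag_pair_weight x y"
    and "0 \<le> K"
  shows "ex (\<lambda>H. (\<Sum>x\<in>flags. h x H)\<^sup>2) \<le> K * (real r)\<^sup>2 * link_weight"
proof -
  have "ex (\<lambda>H. (\<Sum>x\<in>flags. h x H)\<^sup>2) = (\<Sum>x\<in>flags. \<Sum>y\<in>flags. ex (\<lambda>H. h x H * h y H))"
    unfolding power2_eq_square sum_product ex_sum ..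
  also have "\<dots> \<le> (\<Sum>x\<in>flags. \<Sum>y\<in>flags. K * flag_pair_weight x y)"
    by (intro sum_mono assms)
  also have "\<dots> = K * (\<Sum>x\<in>flags. \<Sum>y\<in>flags. flag_pair_weight x y)"
    by (simp add: sum_distrib_left)
  also have "\<dots> \<le> K * ((real r)\<^sup>2 * link_weight)"
    by (intro mult_left_mono sum_flag_pair_weight assms)
  finally show ?thesis by (simp add: mult.assoc)
qed

text \<open>By \<open>ex_cross_moment\<close> a pair contributes only if the marks agree or each
  lies in the other flag set; either way the four members are linked.\<close>

lemma divergence_second_moment:
  "ex (\<lambda>H. (divergence H)\<^sup>2) \<le> (1 - p) * (real r)\<^sup>2 * link_weight"
  unfolding divergence_expand
proof (rule second_moment_flags)
  fix x y assume xy: "x \<in> flags" "y \<in> flags"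
  obtain e A B f C G where eq: "x = (e, A, B)" "y = (f, C, G)" by (cases x, cases y)
  note fx = flagsD[OF xy(1)[unfolded eq]] and fy = flagsD[OF xy(2)[unfolded eq]]
  define c where "c = flag_coeff x * flag_coeff y"
  have c: "0 \<le> c" using p_pos by (simp add: c_def eq)
  define m where "m = ex (\<lambda>H. ((monomial {fst x} H - p) * monomial (flag_set x) H) *
      ((monomial {fst y} H - p) * monomial (flag_set y) H))"
  have m: "m \<le> (if fst x = fst y \<or> (fst x \<in> flag_set y \<and> fst y \<in> flag_set x)
       then (1 - p) * p ^ card (flag_set x \<union> flag_set y \<union> {fst x, fst y}) else 0)"
    unfolding m_def using flag_set_props[OF xy(1)] flag_set_props[OF xy(2)] fx fy
    by (intro ex_cross_moment) (auto simp: eq)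
  have "ex (\<lambda>H. flag_coeff x * ((monomial {fst x} H - p) * monomial (flag_set x) H) *
      (flag_coeff y * ((monomial {fst y} H - p) * monomial (flag_set y) H))) = c * m"
    unfolding m_def c_def ex_cmult[symmetric] by (simp add: mult_ac)
  also have "\<dots> \<le> (1 - p) * flag_pair_weight x y"
  proof (cases "fst x = fst y \<or> (fst x \<in> flag_set y \<and> fst y \<in> flag_set x)")
    case True
    then have "linked A B C G" using fx fy by (auto simp: linked_def eq lower_def)
    then have w: "flag_pair_weight x y = p ^ card (A \<union> B \<union> C \<union> G)"
      by (simp add: flag_pair_weight_def eq)
    have "c * m \<le> c * ((1 - p) * p ^ card (flag_set x \<union> flag_set y \<union> {fst x, fst y}))"
      using m True c by (intro mult_left_mono) auto
    also have "\<dots> = (1 - p) * (c * p ^ card (flag_set x \<union> flag_set y \<union> {fst x, fst y}))"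
      by simp
    also have "\<dots> \<le> (1 - p) * flag_pair_weight x y"
      using flag_pair_power[OF xy] p_less_1 unfolding c_def w
      by (intro mult_left_mono) (auto simp: eq)
    finally show ?thesis .
  next
    case False
    then have "c * m \<le> 0" using m c by (simp only: if_False mult_nonneg_nonpos)
    also have "0 \<le> (1 - p) * flag_pair_weight x y"
      using p_less_1 by (simp add: flag_pair_weight_nonneg)
    finally show ?thesis .
  qed
  finally show "ex (\<lambda>H. flag_coeff x * ((monomial {fst x} H - p) * monomial (flag_set x) H) *
      (flag_coeff y * ((monomial {fst y} H - p) * monomial (flag_set y) H)))
      \<le> (1 - p) * flag_pair_weight x y" .
qed (use p_less_1 in simp)

text \<open>Flags with disjoint flag sets are uncorrelated; the constant \<open>2 * r\<close> bounds
  the size of an intersection.\<close>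

lemma quad_variance:
  "ex (\<lambda>H. (quad H - var)\<^sup>2) \<le> (real (2 * r) * (1 - p)) * (real r)\<^sup>2 * link_weight"
proof -
  define q where "q = p * (1 - p)"
  define h where "h = (\<lambda>x H. q * flag_coeff x * (monomial (flag_set x) H - p ^ card (flag_set x)))"
  have "var = (\<Sum>x\<in>flags. q * flag_coeff x * p ^ card (flag_set x))"
    unfolding ex_quad[symmetric] quad_expand[abs_def] ex_sum ex_cmult q_def[symmetric]
    by (intro sum.cong refl) (simp add: ex_monomial flag_set_props)
  then have quad: "quad H - var = (\<Sum>x\<in>flags. h x H)" for H
    by (simp add: quad_expand h_def q_def sum_subtractf right_diff_distrib)
  show ?thesis unfolding quad
  proof (rule second_moment_flags)
    fix x y assume xy: "x \<in> flags" "y \<in> flags"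
    obtain e A B f C G where eq: "x = (e, A, B)" "y = (f, C, G)" by (cases x, cases y)
    note fx = flagsD[OF xy(1)[unfolded eq]] and fy = flagsD[OF xy(2)[unfolded eq]]
    define c where "c = flag_coeff x * flag_coeff y"
    have c: "0 \<le> c" using p_pos by (simp add: c_def eq)
    define m where "m = ex (\<lambda>H. (monomial (flag_set x) H - p ^ card (flag_set x)) *
        (monomial (flag_set y) H - p ^ card (flag_set y)))"
    have "card (flag_set x \<inter> flag_set y) \<le> 2 * r"
      using flag_set_props[OF xy(1)] card_mono[of "flag_set x" "flag_set x \<inter> flag_set y"] by auto
    then have m: "m \<le> (if flag_set x \<inter> flag_set y \<noteq> {}
         then real (2 * r) * (1 - p) * p ^ card (flag_set x \<union> flag_set y) else 0)"
      unfolding m_def using flag_set_props[OF xy(1)] flag_set_props[OF xy(2)]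
      by (intro ex_monomial_covariance)
    have "ex (\<lambda>H. h x H * h y H) = c * (q\<^sup>2 * m)"
      unfolding m_def c_def h_def ex_cmult[symmetric] by (simp add: mult_ac power2_eq_square)
    also have "\<dots> \<le> real (2 * r) * (1 - p) * flag_pair_weight x y"
    proof (cases "flag_set x \<inter> flag_set y \<noteq> {}")
      case True
      then have "linked A B C G" using fx fy by (auto simp: linked_def eq lower_def)
      then have w: "flag_pair_weight x y = p ^ card (A \<union> B \<union> C \<union> G)"
        by (simp add: flag_pair_weight_def eq)
      define Z where "Z = flag_set x \<union> flag_set y \<union> {fst x, fst y}"
      \<comment> \<open>The marks enlarge the union by at most two elements, and the two factors
        \<open>p\<close> inside \<open>q^2\<close> pay for them.\<close>
      have "card Z \<le> card (flag_set x \<union> flag_set y) + card {fst x, fst y}"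
        unfolding Z_def by (rule card_Un_le)
      also have "card {fst x, fst y} \<le> 2" by (simp add: card_insert_if)
      finally have "p ^ (card (flag_set x \<union> flag_set y) + 2) \<le> p ^ card Z"
        using p_pos p_less_1 by (intro power_decreasing) auto
      moreover have "q\<^sup>2 * p ^ card (flag_set x \<union> flag_set y)
          \<le> p ^ (card (flag_set x \<union> flag_set y) + 2)"
      proof -
        have "q\<^sup>2 \<le> p\<^sup>2" using p_pos p_less_1
          by (intro power_mono) (auto simp: q_def mult_left_le)
        then show ?thesis using p_pos by (simp add: power_add mult.commute power2_eq_square)
      qed
      ultimately have qZ: "q\<^sup>2 * p ^ card (flag_set x \<union> flag_set y) \<le> p ^ card Z" by linarith
      have "c * (q\<^sup>2 * m) \<le> c * (q\<^sup>2 * (real (2 * r) * (1 - p) * p ^ card (flag_set x \<union> flag_set y)))"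
        using m True c by (intro mult_left_mono) auto
      also have "\<dots> = real (2 * r) * (1 - p) * (c * (q\<^sup>2 * p ^ card (flag_set x \<union> flag_set y)))"
        by (simp only: mult_ac)
      also have "\<dots> \<le> real (2 * r) * (1 - p) * (c * p ^ card Z)"
        using qZ c p_less_1 by (intro mult_left_mono) auto
      also have "\<dots> \<le> real (2 * r) * (1 - p) * flag_pair_weight x y"
        using flag_pair_power[OF xy] p_less_1 unfolding c_def w Z_def
        by (intro mult_left_mono) (auto simp: eq)
      finally show ?thesis .
    next
      case False
      then have "m \<le> 0" using m by (simp only: if_False simp_thms)
      then have "c * (q\<^sup>2 * m) \<le> 0" using c by (simp add: mult_nonneg_nonpos)
      also have "0 \<le> real (2 * r) * (1 - p) * flag_pair_weight x y"
        using p_less_1 by (simp add: flag_pair_weight_nonneg)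
      finally show ?thesis .
    qed
    finally show "ex (\<lambda>H. h x H * h y H) \<le> real (2 * r) * (1 - p) * flag_pair_weight x y" .
  qed (use p_less_1 in simp)
qed

lemma link_weight_nonneg: "0 \<le> link_weight"
  unfolding link_weight_def using p_pos by (intro sum_nonneg) auto

theorem normal_approximation_links:
  assumes var_pos: "0 < var"
  shows "\<bar>ex (\<lambda>H. of_bool ((total H - mean) / sqrt var \<le> z)) - std_normal_cdf z\<bar>
    \<le> 8 * (real r)\<^sup>2 * sqrt ((1 - p) * link_weight) / var"
proof -
  define X where "X = (1 - p) * link_weight"
  have X: "0 \<le> X" using p_less_1 link_weight_nonneg by (simp add: X_def)
  \<comment> \<open>Both second-moment constants, \<open>2 r^3\<close> and \<open>r^2\<close>, are
    absorbed into the square of \<open>2 r^2\<close>; two first moments and the prefactor 2 then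
    give 8.\<close>
  have r: "real r \<le> (real r)\<^sup>2" "2 * real r * (real r)\<^sup>2 \<le> (2 * (real r)\<^sup>2)\<^sup>2"
    "real r * real r \<le> (2 * (real r)\<^sup>2)\<^sup>2"
  proof -
    show 1: "real r \<le> (real r)\<^sup>2" by (cases r) (auto simp: power2_eq_square)
    have sq: "(2 * (real r)\<^sup>2)\<^sup>2 = 4 * ((real r)\<^sup>2 * (real r)\<^sup>2)"
      by (simp add: power2_eq_square)
    have nonneg: "0 \<le> (real r)\<^sup>2 * (real r)\<^sup>2" by simp
    have "real r * (real r)\<^sup>2 \<le> (real r)\<^sup>2 * (real r)\<^sup>2"
      using 1 by (intro mult_right_mono) auto
    then show "2 * real r * (real r)\<^sup>2 \<le> (2 * (real r)\<^sup>2)\<^sup>2"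
      unfolding sq using nonneg by linarith
    have "real r * real r \<le> (real r)\<^sup>2 * (real r)\<^sup>2"
      using 1 by (intro mult_mono) auto
    then show "real r * real r \<le> (2 * (real r)\<^sup>2)\<^sup>2"
      unfolding sq using nonneg by linarith
  qed
  have moment: "ex (\<lambda>H. \<bar>h H\<bar>) \<le> 2 * (real r)\<^sup>2 * sqrt X"
    if "ex (\<lambda>H. (h H)\<^sup>2) \<le> a * X" "a \<le> (2 * (real r)\<^sup>2)\<^sup>2" for h :: "'e set \<Rightarrow> real" and a
  proof -
    have "ex (\<lambda>H. \<bar>h H\<bar>) \<le> sqrt (ex (\<lambda>H. (h H)\<^sup>2))" by (rule ex_abs_le_sqrt)
    also have "\<dots> \<le> sqrt ((2 * (real r)\<^sup>2)\<^sup>2 * X)"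
      using that(1) mult_right_mono[OF that(2) X] by simp
    also have "\<dots> = 2 * (real r)\<^sup>2 * sqrt X"
      by (subst real_sqrt_mult, subst real_sqrt_abs) simp
    finally show ?thesis .
  qed
  have "ex (\<lambda>H. (quad H - var)\<^sup>2) \<le> (2 * real r * (real r)\<^sup>2) * X"
    using quad_variance by (simp add: X_def algebra_simps)
  moreover have "ex (\<lambda>H. (divergence H)\<^sup>2) \<le> (real r * real r) * X"
    using divergence_second_moment by (simp add: X_def mult_ac power2_eq_square)
  ultimately have "ex (\<lambda>H. \<bar>quad H - var\<bar>) + ex (\<lambda>H. \<bar>divergence H\<bar>) \<le> 4 * (real r)\<^sup>2 * sqrt X"
    using moment[OF _ r(2)] moment[OF _ r(3)] by fastforce
  then have "2 / var * (ex (\<lambda>H. \<bar>quad H - var\<bar>) + ex (\<lambda>H. \<bar>divergence H\<bar>))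
      \<le> 2 / var * (4 * (real r)\<^sup>2 * sqrt X)"
    using var_pos by (intro mult_left_mono) auto
  then show ?thesis
    using normal_approximation[OF var_pos, of z] by (simp add: X_def)
qed

text \<open>A linked quadruple is a chain: up to exchanging \<open>C\<close> and \<open>G\<close>, every set meets the union of its
  predecessors.\<close>

lemma link_weight_le:
  assumes R: "\<And>H. finite H \<Longrightarrow> H \<subseteq> D \<Longrightarrow> card H \<le> 3 * r \<Longrightarrow> (\<Sum>A\<in>{A \<in> T. A \<inter> H \<noteq> {}}. p ^ card (A - H)) \<le> R"
  shows "link_weight \<le> 2 * mean * R ^ 3"
proof -
  define I where "I = (\<lambda>H. {A \<in> T. A \<inter> H \<noteq> {}})"
  have finI: "finite (I H)" for H using finite_T by (simp add: I_def)
  have R0: "0 \<le> R" using R[of "{}"] by simp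
  \<comment> \<open>Adjoining one further member that meets \<open>H\<close> costs a factor
    \<open>R\<close>; three earlier members have at most \<open>3 * r\<close> elements.\<close>
  have *: "(\<Sum>A\<in>I H. p ^ card (H \<union> A)) \<le> p ^ card H * R" if "finite H" "H \<subseteq> D" "card H \<le> 3 * r" for H
  proof -
    have "card (H \<union> A) = card H + card (A - H)" if "A \<in> T" for A
      using card_Un_disjoint[of H "A - H"] \<open>finite H\<close> finite_member[OF that] by simp
    then have "(\<Sum>A\<in>I H. p ^ card (H \<union> A)) = p ^ card H * (\<Sum>A\<in>I H. p ^ card (A - H))"
      by (simp add: sum_distrib_left I_def power_add)
    also have "\<dots> \<le> p ^ card H * R"
      using R[OF that] p_pos by (intro mult_left_mono) (auto simp: I_def)
    finally show ?thesis .
  qed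
  have un: "finite (A \<union> H)" "A \<union> H \<subseteq> D" "card (H \<union> A) \<le> card H + r"
    if "A \<in> T" "finite H" "H \<subseteq> D" for A H
    using that members finite_member card_member[OF that(1)] card_Un_le[of H A] by auto
  define chains where "chains = (SIGMA A:T. SIGMA B:I A. SIGMA C:I (A \<union> B). I (A \<union> B \<union> C))"
  define w where "w = (\<lambda>(A, B, C, G). p ^ card (A \<union> B \<union> C \<union> G :: 'e set))"
  have w: "0 \<le> w Q" for Q using p_pos by (auto simp: w_def split: prod.splits)
  have fin: "finite chains" unfolding chains_def using finite_T finI by (intro finite_SigmaI)
  \<comment> \<open>Summing out \<open>G\<close>, \<open>C\<close> and \<open>B\<close> in this
    order yields \<open>R\<close> each time; the remaining sum over \<open>A\<close> is the
    mean.\<close>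
  have chain: "(\<Sum>Q\<in>chains. w Q) \<le> mean * R ^ 3"
  proof -
    have "(\<Sum>Q\<in>chains. w Q) = (\<Sum>A\<in>T. \<Sum>B\<in>I A. \<Sum>C\<in>I (A \<union> B). \<Sum>G\<in>I (A \<union> B \<union> C). p ^ card (A \<union> B \<union> C \<union> G))"
      unfolding chains_def w_def using finite_T finI by (simp add: sum.Sigma)
    also have "\<dots> \<le> (\<Sum>A\<in>T. \<Sum>B\<in>I A. \<Sum>C\<in>I (A \<union> B). p ^ card (A \<union> B \<union> C) * R)"
    proof (intro sum_mono *)
      fix A B C assume "A \<in> T" "B \<in> I A" "C \<in> I (A \<union> B)"
      then have T: "A \<in> T" "B \<in> T" "C \<in> T" by (auto simp: I_def)
      then show "finite (A \<union> B \<union> C)" "A \<union> B \<union> C \<subseteq> D" using finite_member members by auto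
      show "card (A \<union> B \<union> C) \<le> 3 * r"
        using card_Un_le[of "A \<union> B" C] card_Un_le[of A B] T card_member by fastforce
    qed
    also have "\<dots> = (\<Sum>A\<in>T. \<Sum>B\<in>I A. \<Sum>C\<in>I (A \<union> B). p ^ card (A \<union> B \<union> C)) * R"
      by (simp add: sum_distrib_right)
    also have "\<dots> \<le> (\<Sum>A\<in>T. \<Sum>B\<in>I A. p ^ card (A \<union> B) * R) * R"
    proof (intro mult_right_mono[OF _ R0] sum_mono *)
      fix A B assume "A \<in> T" "B \<in> I A"
      then have T: "A \<in> T" "B \<in> T" by (auto simp: I_def)
      then show "finite (A \<union> B)" "A \<union> B \<subseteq> D" using finite_member members by auto
      show "card (A \<union> B) \<le> 3 * r"
        using card_Un_le[of A B] T card_member by fastforce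
    qed
    also have "\<dots> = (\<Sum>A\<in>T. \<Sum>B\<in>I A. p ^ card (A \<union> B)) * R * R"
      by (simp add: sum_distrib_right)
    also have "\<dots> \<le> (\<Sum>A\<in>T. p ^ card A * R) * R * R"
      using finite_member members card_member
      by (intro mult_right_mono[OF _ R0] sum_mono *) auto
    also have "\<dots> = mean * R ^ 3"
      by (simp add: card_member mean_def power3_eq_cube)
    finally show ?thesis .
  qed
  define swap where "swap = (\<lambda>(A :: 'e set, B :: 'e set, C :: 'e set, G :: 'e set). (A, B, G, C))"
  have "links \<subseteq> chains \<union> swap ` chains"
  proof
    fix Q assume Q: "Q \<in> links"
    obtain A B C G where Q': "Q = (A, B, C, G)" by (cases Q)
    have T: "A \<in> T" "B \<in> T" "C \<in> T" "G \<in> T" "A \<inter> B \<noteq> {}" "C \<inter> G \<noteq> {}" "(A \<union> B) \<inter> (C \<union> G) \<noteq> {}"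
      using Q by (auto simp: links_def linked_def Q')
    show "Q \<in> chains \<union> swap ` chains"
    proof (cases "C \<inter> (A \<union> B) \<noteq> {}")
      case True
      then have "Q \<in> chains" using T by (auto simp: chains_def Q' I_def)
      then show ?thesis by simp
    next
      case False
      then have "(A, B, G, C) \<in> chains" using T by (auto simp: chains_def I_def)
      then have "swap (A, B, G, C) \<in> swap ` chains" by (rule imageI)
      then show ?thesis by (simp add: swap_def Q')
    qed
  qed
  then have "link_weight \<le> (\<Sum>Q\<in>chains \<union> swap ` chains. w Q)"
    unfolding link_weight_def w_def[symmetric] using fin w by (intro sum_mono2) auto
  also have "\<dots> \<le> (\<Sum>Q\<in>chains. w Q) + (\<Sum>Q\<in>swap ` chains. w Q)"
    using fin w by (simp add: sum_Un sum_nonneg)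
  also have "(\<Sum>Q\<in>swap ` chains. w Q) = (\<Sum>Q\<in>chains. w (swap Q))"
    by (rule sum.reindex_cong[of swap]) (auto simp: inj_on_def swap_def)
  also have "\<dots> = (\<Sum>Q\<in>chains. w Q)"
    by (intro sum.cong refl) (auto simp: w_def swap_def Un_ac)
  finally show ?thesis using chain by simp
qed

section \<open>Lower bounds for the variance\<close>

lemma var_expand: "var = (\<Sum>A\<in>T. \<Sum>B\<in>T. p ^ card (A \<union> B) - p ^ (2 * r))"
proof -
  have e: "ex total = mean"
    unfolding total_def[abs_def] ex_sum mean_def by (simp add: ex_monomial members card_member)
  have "var = ex (\<lambda>H. total H * total H - (2 * mean) * total H + mean\<^sup>2)"
    unfolding var_def by (simp add: power2_eq_square algebra_simps)
  also have "\<dots> = ex (\<lambda>H. total H * total H) - mean\<^sup>2"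
    unfolding ex_add ex_diff ex_cmult ex_const e by (simp add: power2_eq_square)
  also have "ex (\<lambda>H. total H * total H) = (\<Sum>A\<in>T. \<Sum>B\<in>T. p ^ card (A \<union> B))"
    unfolding total_def sum_product ex_sum monomial_mult
    by (intro sum.cong refl ex_monomial) (simp add: members)
  also have "mean\<^sup>2 = (\<Sum>A\<in>T. \<Sum>B\<in>T. p ^ (2 * r))"
    by (simp add: mean_def power2_eq_square mult_2 power_add)
  finally show ?thesis by (simp add: sum_subtractf)
qed

lemma var_term_nonneg:
  assumes "A \<in> T" "B \<in> T"
  shows "0 \<le> p ^ card (A \<union> B) - p ^ (2 * r)"
proof -
  have "card (A \<union> B) \<le> 2 * r" using card_Un_le[of A B] assms card_member by simp
  then show ?thesis using p_pos p_less_1 by (simp add: power_decreasing)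
qed

text \<open>Keeps only the terms with \<open>A = B\<close>; used when the expected number of copies
  attains the minimum.\<close>

lemma var_ge_diagonal:
  assumes "1 \<le> r"
  shows "real (card T) * (p ^ r * (1 - p)) \<le> var"
proof -
  have "p ^ (2 * r) \<le> p ^ (r + 1)" using assms p_pos p_less_1 by (intro power_decreasing) auto
  then have "real (card T) * (p ^ r * (1 - p)) \<le> real (card T) * (p ^ r - p ^ (2 * r))"
    by (intro mult_left_mono) (auto simp: algebra_simps)
  also have "\<dots> = (\<Sum>A\<in>T. p ^ r - p ^ (2 * r))" by simp
  also have "\<dots> = (\<Sum>A\<in>T. \<Sum>B\<in>{A}. p ^ card (A \<union> B) - p ^ (2 * r))"
    by (simp add: card_member)
  also have "\<dots> \<le> var"
    unfolding var_expand using finite_T var_term_nonneg by (intro sum_mono sum_mono2) auto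
  finally show ?thesis .
qed

text \<open>Cauchy-Schwarz for the degrees \<open>d e\<close>: they add up to
  \<open>r * card T\<close>, while their squares count pairs with a common element, each at most
  \<open>r\<close> times.\<close>

lemma card_pairs_ge:
  assumes "1 \<le> r"
  shows "(real (card T))\<^sup>2 \<le> real (card D) * (\<Sum>A\<in>T. real (card {B \<in> T. A \<inter> B \<noteq> {}}))"
proof -
  define d where "d = (\<lambda>e. real (card (containing e)))"
  have d: "(\<Sum>e\<in>D. d e) = real (card T) * real r"
    using sum_containing[of "\<lambda>_ _. 1"] by (simp add: d_def card_member)
  have "(\<Sum>e\<in>D. (d e)\<^sup>2) = (\<Sum>e\<in>D. \<Sum>A\<in>containing e. d e)"
    by (simp add: d_def power2_eq_square)
  also have "\<dots> = (\<Sum>A\<in>T. \<Sum>e\<in>A. d e)" by (rule sum_containing)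
  also have "\<dots> \<le> (\<Sum>A\<in>T. real r * real (card {B \<in> T. A \<inter> B \<noteq> {}}))"
  proof (rule sum_mono)
    fix A assume A: "A \<in> T"
    have "(\<Sum>e\<in>A. d e) \<le> (\<Sum>e\<in>A. real (card {B \<in> T. A \<inter> B \<noteq> {}}))"
      unfolding d_def using finite_T by (intro sum_mono of_nat_mono card_mono) auto
    then show "(\<Sum>e\<in>A. d e) \<le> real r * real (card {B \<in> T. A \<inter> B \<noteq> {}})"
      using card_member[OF A] by simp
  qed
  finally have d2: "(\<Sum>e\<in>D. (d e)\<^sup>2) \<le> real r * (\<Sum>A\<in>T. real (card {B \<in> T. A \<inter> B \<noteq> {}}))"
    by (simp add: sum_distrib_left)
  have "(real (card T) * real r)\<^sup>2 \<le> real (card D) * (\<Sum>e\<in>D. (d e)\<^sup>2)"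
    using Cauchy_Schwarz_ineq_sum[of "\<lambda>_. 1" d D] by (simp add: d)
  also have "\<dots> \<le> real (card D) * (real r * (\<Sum>A\<in>T. real (card {B \<in> T. A \<inter> B \<noteq> {}})))"
    by (intro mult_left_mono d2) auto
  finally have "real r * (real r * (real (card T))\<^sup>2)
      \<le> real r * (real (card D) * (\<Sum>A\<in>T. real (card {B \<in> T. A \<inter> B \<noteq> {}})))"
    by (simp add: power2_eq_square mult_ac)
  then have le: "real r * (real (card T))\<^sup>2
      \<le> real (card D) * (\<Sum>A\<in>T. real (card {B \<in> T. A \<inter> B \<noteq> {}}))"
    using assms by simp
  have "1 * (real (card T))\<^sup>2 \<le> real r * (real (card T))\<^sup>2"
    using assms by (intro mult_right_mono) auto
  with le show ?thesis by simp
qed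

text \<open>A pair that meets has a union of at most \<open>2 * r - 1\<close> elements;
  \<open>card_pairs_ge\<close> supplies many such pairs.\<close>

lemma var_ge_overlap:
  assumes "1 \<le> r"
  shows "p ^ (2 * r - 1) * (1 - p) * (real (card T))\<^sup>2 \<le> real (card D) * var"
proof -
  define c where "c = p ^ (2 * r - 1) * (1 - p)"
  have c: "0 \<le> c" using p_pos p_less_1 by (simp add: c_def)
  have c': "c = p ^ (2 * r - 1) - p ^ (2 * r)"
  proof -
    obtain k where "2 * r = Suc k" using assms by (cases "2 * r") auto
    then show ?thesis by (simp add: c_def algebra_simps)
  qed
  have "c * (\<Sum>A\<in>T. real (card {B \<in> T. A \<inter> B \<noteq> {}})) = (\<Sum>A\<in>T. \<Sum>B\<in>{B \<in> T. A \<inter> B \<noteq> {}}. c)"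
    by (simp add: sum_distrib_left mult.commute)
  also have "\<dots> \<le> (\<Sum>A\<in>T. \<Sum>B\<in>{B \<in> T. A \<inter> B \<noteq> {}}. p ^ card (A \<union> B) - p ^ (2 * r))"
  proof (intro sum_mono)
    fix A B assume A: "A \<in> T" and "B \<in> {B \<in> T. A \<inter> B \<noteq> {}}"
    then have B: "B \<in> T" "card (A \<inter> B) > 0" using finite_member by (auto simp: card_gt_0_iff)
    have "card (A \<union> B) + card (A \<inter> B) = 2 * r"
      using card_Un_Int[of A B] A B finite_member card_member by simp
    then have "card (A \<union> B) \<le> 2 * r - 1" using B by linarith
    then show "c \<le> p ^ card (A \<union> B) - p ^ (2 * r)"
      unfolding c' using p_pos p_less_1 by (simp add: power_decreasing)
  qed
  also have "\<dots> \<le> var"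
    unfolding var_expand using finite_T var_term_nonneg by (intro sum_mono sum_mono2) auto
  finally have "real (card D) * (c * (\<Sum>A\<in>T. real (card {B \<in> T. A \<inter> B \<noteq> {}}))) \<le> real (card D) * var"
    by (intro mult_left_mono) auto
  moreover have "c * (real (card T))\<^sup>2 \<le> c * (real (card D) * (\<Sum>A\<in>T. real (card {B \<in> T. A \<inter> B \<noteq> {}})))"
    using c by (intro mult_left_mono card_pairs_ge assms)
  ultimately show ?thesis unfolding c_def by (simp add: mult_ac)
qed

end

section \<open>Trees\<close>

text \<open>The first vertex of a longest path: another neighbour would either prolong the path or
  close a cycle with it.\<close>

lemma acyclic_has_leaf:
  assumes K: "finite K" "K \<noteq> {}" "K \<subseteq> nsets V 2" and acyclic: "\<nexists>xs. is_cycle K xs"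
  shows "\<exists>v e. e \<in> K \<and> v \<in> e \<and> (\<forall>e'\<in>K. v \<in> e' \<longrightarrow> e' = e)"
proof -
  define path where "path = (\<lambda>xs. distinct xs \<and> length xs \<ge> 2 \<and> set xs \<subseteq> \<Union>K \<and>
     (\<forall>i. Suc i < length xs \<longrightarrow> {xs ! i, xs ! Suc i} \<in> K))"
  have finU: "finite (\<Union>K)"
    using K by (auto simp: nsets_def)
  obtain x y where xy: "{x, y} \<in> K" "x \<noteq> y"
    using K by (metis all_not_in_conv nsets2_E subsetD)
  then have "path [x, y]" by (auto simp: path_def)
  have bound: "length xs \<le> card (\<Union>K)" if "path xs" for xs
    using that finU by (metis card_mono distinct_card path_def)
  obtain xs where xs: "path xs" and longest: "\<And>ys. path ys \<Longrightarrow> length ys \<le> length xs"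
    using ex_has_greatest_nat[of path "[x, y]" length "Suc (card (\<Union>K))"] \<open>path [x, y]\<close> bound
    by (metis le_imp_less_Suc)
  define v where "v = xs ! 0"
  have len: "2 \<le> length xs" and dist: "distinct xs"
    and adj: "\<And>i. Suc i < length xs \<Longrightarrow> {xs ! i, xs ! Suc i} \<in> K"
    using xs by (auto simp: path_def)
  have e: "{v, xs ! 1} \<in> K" using adj[of 0] len by (simp add: v_def)
  have "e' = {v, xs ! 1}" if e': "e' \<in> K" "v \<in> e'" for e'
  proof -
    obtain w where w: "e' = {v, w}" "w \<noteq> v"
    proof -
      obtain a b where "e' = {a, b}" "a \<noteq> b" using K e' by (metis nsets2_E subsetD)
      then show ?thesis using that[of a] that[of b] e'(2) by (cases "v = a") auto
    qed
    have "w \<in> set xs"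
    proof (rule ccontr)
      assume "w \<notin> set xs"
      moreover have "w \<in> \<Union>K" using w e' by auto
      moreover have "{(w # xs) ! i, (w # xs) ! Suc i} \<in> K" if "Suc i < length (w # xs)" for i
      proof (cases i)
        case 0
        then show ?thesis using e'(1) by (simp add: w(1) v_def[symmetric] insert_commute)
      next
        case (Suc j)
        then show ?thesis using that adj[of j] by simp
      qed
      ultimately have "path (w # xs)" using xs by (auto simp: path_def)
      then show False using longest by fastforce
    qed
    then obtain i where i: "i < length xs" "w = xs ! i" by (metis in_set_conv_nth)
    have "i = 1"
    proof (rule ccontr)
      assume "i \<noteq> 1"
      moreover have "i \<noteq> 0" using i w(2) by (metis v_def)
      ultimately have i2: "2 \<le> i" by simp
      \<comment> \<open>The path up to \<open>w\<close>, closed by the edge \<open>e'\<close>;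
        \<open>i \<ge> 2\<close> gives the three vertices that a cycle needs.\<close>
      have "is_cycle K (take (Suc i) xs)"
        unfolding is_cycle_def
      proof (intro conjI allI impI)
        show "3 \<le> length (take (Suc i) xs)" "distinct (take (Suc i) xs)"
          using i i2 dist by auto
        fix j assume j: "j < length (take (Suc i) xs)"
        show "{take (Suc i) xs ! j, take (Suc i) xs ! (Suc j mod length (take (Suc i) xs))} \<in> K"
        proof (cases "j = i")
          case True
          then show ?thesis using i e'(1) by (simp add: w(1) v_def insert_commute)
        next
          case False
          then have "Suc j < Suc i" using j by simp
          then show ?thesis using i j adj[of j] by simp
        qed
      qed
      then show False using acyclic by blast
    qed
    then show ?thesis using w(1) i by simp
  qed
  then show ?thesis using e by blast
qed

text \<open>Removing the edge at a leaf also removes the leaf from the covered vertices; a single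
  edge covers two.\<close>

lemma forest_card_vertices:
  assumes "finite K" "K \<noteq> {}" "K \<subseteq> nsets V 2" "\<nexists>xs. is_cycle K xs"
  shows "card K + 1 \<le> card (\<Union>K)"
  using assms
proof (induction "card K" arbitrary: K rule: less_induct)
  case less
  obtain v e where e: "e \<in> K" "v \<in> e" and leaf: "\<forall>e'\<in>K. v \<in> e' \<longrightarrow> e' = e"
    using acyclic_has_leaf[OF less.prems] by blast
  have e2: "card e = 2" using e less.prems(3) by (auto simp: nsets_def)
  have fin: "finite (\<Union>K)" using less.prems(1,3) by (auto simp: nsets_def)
  show ?case
  proof (cases "K = {e}")
    case True
    then show ?thesis using e2 by simp
  next
    case False
    define K' where "K' = K - {e}"
    have K': "card K' < card K" "finite K'" "K' \<noteq> {}" "K' \<subseteq> nsets V 2" "card K = card K' + 1"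
      using less.prems e False by (auto simp: K'_def card_gt_0_iff)
    have "is_cycle K xs" if "is_cycle K' xs" for xs
      using that unfolding is_cycle_def K'_def by blast
    then have "\<nexists>xs. is_cycle K' xs" using less.prems(4) by blast
    with less.hyps[OF K'(1-4)] have "card K' + 1 \<le> card (\<Union>K')" by simp
    moreover have "\<Union>K' \<subseteq> \<Union>K - {v}" using leaf by (auto simp: K'_def)
    then have "card (\<Union>K') \<le> card (\<Union>K) - 1"
      using fin e by (metis UnionI card_Diff_singleton card_mono finite_Diff)
    moreover have "card (\<Union>K) \<noteq> 0" using fin e by auto
    ultimately show ?thesis using K'(5) by linarith
  qed
qed

text \<open>Grows a vertex set one vertex at a time: a walk to a vertex outside crosses the boundary
  along an edge not yet counted.\<close>

lemma connected_card_edges: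
  assumes "finite V" "E \<subseteq> nsets V 2" "connected_graph V E" "1 \<le> k" "k \<le> card V"
  shows "\<exists>S\<subseteq>V. card S = k \<and> k - 1 \<le> card {e \<in> E. e \<subseteq> S}"
  using assms(4,5)
proof (induction k rule: dec_induct)
  case base
  obtain v where "v \<in> V" using assms(3) by (auto simp: connected_graph_def)
  then show ?case by (intro exI[of _ "{v}"]) auto
next
  case (step k)
  then obtain S where S: "S \<subseteq> V" "card S = k" "k - 1 \<le> card {e \<in> E. e \<subseteq> S}" by auto
  have finE: "finite E" using assms(1,2) by (meson finite_imp_finite_nsets finite_subset)
  have finS: "finite S" using S(1) assms(1) finite_subset by blast
  obtain u where u: "u \<in> S" using S(2) step by fastforce
  obtain w where w: "w \<in> V" "w \<notin> S" using S step by (metis Suc_n_not_le_n subsetI subset_antisym)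
  have "(u, w) \<in> {(x, y). {x, y} \<in> E}\<^sup>*"
    using assms(3) u w S(1) by (auto simp: connected_graph_def)
  then have "\<exists>x y. x \<in> S \<and> y \<notin> S \<and> {x, y} \<in> E"
    using u w(2)
  proof (induction rule: rtrancl_induct)
    case (step y z)
    then show ?case by (cases "y \<in> S") auto
  qed simp
  then obtain x y where xy: "x \<in> S" "y \<notin> S" "{x, y} \<in> E" by blast
  have yV: "y \<in> V" using xy assms(2) by (auto simp: nsets_def)
  have "insert {x, y} {e \<in> E. e \<subseteq> S} \<subseteq> {e \<in> E. e \<subseteq> insert y S}"
    using xy by auto
  then have "card (insert {x, y} {e \<in> E. e \<subseteq> S}) \<le> card {e \<in> E. e \<subseteq> insert y S}"
    using finE by (intro card_mono) auto
  moreover have "card (insert {x, y} {e \<in> E. e \<subseteq> S}) = Suc (card {e \<in> E. e \<subseteq> S})"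
    using finE xy by (intro card_insert_disjoint) auto
  ultimately show ?case
    using S xy yV finS step by (intro exI[of _ "insert y S"]) auto
qed

text \<open>The forest bound gives \<open>card E + 1 \<le> card (\<Union>E)\<close>, connectedness
  \<open>card V - 1 \<le> card E\<close>, so all inequalities are tight. Having an edge excludes the
  one-vertex tree, whose vertex no edge covers.\<close>

lemma tree_properties:
  assumes "is_tree V E" "1 \<le> card E"
  shows "finite V" "finite E" "E \<subseteq> nsets V 2" "card V = card E + 1" "\<Union>E = V"
    "\<And>K. K \<subseteq> E \<Longrightarrow> K \<noteq> {} \<Longrightarrow> card K + 1 \<le> card (\<Union>K)"
proof -
  show finV: "finite V" and E: "E \<subseteq> nsets V 2"
    using assms(1) by (auto simp: is_tree_def simple_graph_def)
  then show finE: "finite E" by (meson finite_imp_finite_nsets finite_subset)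
  show forest: "card K + 1 \<le> card (\<Union>K)" if K: "K \<subseteq> E" "K \<noteq> {}" for K
  proof (rule forest_card_vertices)
    show "finite K" "K \<noteq> {}" "K \<subseteq> nsets V 2" using K finE E finite_subset by auto
    show "\<nexists>xs. is_cycle K xs"
      using assms(1) K unfolding is_tree_def is_cycle_def by blast
  qed
  have UE: "\<Union>E \<subseteq> V" using E by (auto simp: nsets_def)
  have ge: "card E + 1 \<le> card (\<Union>E)" using assms(2) by (intro forest) auto
  have Vne: "1 \<le> card V" using ge card_mono[OF finV UE] by linarith
  obtain S where S: "S \<subseteq> V" "card V - 1 \<le> card {e \<in> E. e \<subseteq> S}"
    using connected_card_edges[OF finV E _ Vne order.refl] assms(1) by (auto simp: is_tree_def)
  moreover have "card {e \<in> E. e \<subseteq> S} \<le> card E" using finE by (intro card_mono) auto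
  ultimately show card: "card V = card E + 1" using ge card_mono[OF finV UE] by linarith
  show "\<Union>E = V" by (rule card_subset_eq[OF finV UE]) (use ge card card_mono[OF finV UE] in linarith)
qed

section \<open>Copies of a graph in the complete graph\<close>

text \<open>Extensional functions, so that values outside \<open>V\<close> do not multiply the
  embeddings.\<close>

definition embeddings :: "'a set \<Rightarrow> nat \<Rightarrow> ('a \<Rightarrow> nat) set" where
  "embeddings V n = {f \<in> V \<rightarrow>\<^sub>E {..<n}. inj_on f V}"

text \<open>A copy is recorded by its edge set alone, which makes the copies a set system over the
  edges of the complete graph.\<close>

definition copies :: "'a set \<Rightarrow> 'a set set \<Rightarrow> nat \<Rightarrow> nat set set set" where
  "copies V E n = (\<lambda>f. (`) f ` E) ` embeddings V n"

locale spanned_graph =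
  fixes V :: "'a set" and E :: "'a set set"
  assumes finite_V: "finite V" and edges: "E \<subseteq> nsets V 2" and spanned: "\<Union>E = V"
begin

lemma finite_E: "finite E"
  using finite_V edges by (meson finite_imp_finite_nsets finite_subset)

lemma finite_embeddings: "finite (embeddings V n)"
  by (rule finite_subset[of _ "V \<rightarrow>\<^sub>E {..<n}"]) (auto simp: embeddings_def intro!: finite_PiE finite_V)

lemma inj_on_image_edges: "f \<in> embeddings V n \<Longrightarrow> inj_on ((`) f) E"
  using edges by (intro inj_on_subset[OF inj_on_image_Pow]) (auto simp: embeddings_def nsets_def)

lemma image_edges_nsets: "inj_on f V \<Longrightarrow> f ` V \<subseteq> W \<Longrightarrow> (`) f ` E \<subseteq> nsets W 2"
  using edges unfolding nsets_def
  by (auto simp: card_image inj_on_subset)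

lemma copies_nsets: "F \<in> copies V E n \<Longrightarrow> F \<subseteq> nsets {..<n} 2"
proof -
  assume "F \<in> copies V E n"
  then obtain f where "F = (`) f ` E" "inj_on f V" "f ` V \<subseteq> {..<n}"
    unfolding copies_def embeddings_def by (auto simp: image_subset_iff_funcset)
  then show ?thesis using image_edges_nsets by simp
qed

lemma card_copy: "F \<in> copies V E n \<Longrightarrow> card F = card E"
  unfolding copies_def using card_image[OF inj_on_image_edges] by auto

text \<open>Without isolated vertices the vertex set of a subgraph is the union of its edges, so
  projecting to edge sets is injective.\<close>

lemma subgraph_count_eq:
  assumes "H \<subseteq> nsets {..<n} 2"
  shows "subgraph_count V E {..<n} H = card {F \<in> copies V E n. F \<subseteq> H}"
proof -
  define S where "S = {(W, F). W \<subseteq> {..<n} \<and> F \<subseteq> H \<and> simple_graph W F \<and> graph_isomorphic V E W F}"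
  have "inj_on snd S"
  proof (rule inj_onI)
    have W: "W = \<Union>F" if "(W, F) \<in> S" for W F
    proof -
      have "graph_isomorphic V E W F" using that by (simp add: S_def)
      then obtain f where "bij_betw f V W" "(`) f ` E = F" unfolding graph_isomorphic_def by blast
      then have "\<Union>F = f ` \<Union>E" "W = f ` V" by (auto simp: bij_betw_def)
      then show ?thesis by (simp add: spanned)
    qed
    fix x y assume "x \<in> S" "y \<in> S" "snd x = snd y"
    then show "x = y" using W by (metis prod.collapse)
  qed
  moreover have "snd ` S = {F \<in> copies V E n. F \<subseteq> H}"
  proof (intro equalityI subsetI)
    fix F assume "F \<in> snd ` S"
    then obtain W where WF: "(W, F) \<in> S" by auto
    then have "graph_isomorphic V E W F" by (simp add: S_def)
    then obtain f where f: "bij_betw f V W" "(`) f ` E = F" unfolding graph_isomorphic_def by blast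
    have "W \<subseteq> {..<n}" "F \<subseteq> H" using WF by (auto simp: S_def)
    have emb: "restrict f V \<in> embeddings V n"
      using f \<open>W \<subseteq> {..<n}\<close> by (auto simp: embeddings_def bij_betw_def inj_on_def)
    have img: "(`) (restrict f V) ` E = F"
    proof -
      have "restrict f V ` e = f ` e" if "e \<in> E" for e
        using that spanned by (intro image_cong) auto
      then show ?thesis using f(2) by (auto simp: image_iff)
    qed
    have "F \<in> copies V E n"
      unfolding copies_def by (rule image_eqI[where x = "restrict f V"]) (rule img[symmetric], rule emb)
    then show "F \<in> {F \<in> copies V E n. F \<subseteq> H}" using \<open>F \<subseteq> H\<close> by simp
  next
    fix F assume F: "F \<in> {F \<in> copies V E n. F \<subseteq> H}"
    then obtain f where f: "f \<in> embeddings V n" "F = (`) f ` E" by (auto simp: copies_def)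
    then have inj: "inj_on f V" and W: "f ` V \<subseteq> {..<n}" by (auto simp: embeddings_def)
    have "(f ` V, F) \<in> S"
      unfolding S_def simple_graph_def graph_isomorphic_def
      using F f W inj finite_V image_edges_nsets[OF inj] by (auto simp: bij_betw_def)
    then show "F \<in> snd ` S" by force
  qed
  ultimately show ?thesis
    unfolding subgraph_count_def S_def[symmetric] by (metis card_image)
qed

section \<open>The number of copies\<close>

lemma card_embeddings_le: "card (embeddings V n) \<le> n ^ card V"
proof -
  have "card (embeddings V n) \<le> card (V \<rightarrow>\<^sub>E {..<n})"
    by (intro card_mono finite_PiE finite_V) (auto simp: embeddings_def)
  then show ?thesis by (simp add: card_funcsetE finite_V)
qed

lemma card_copies_le: "card (copies V E n) \<le> n ^ card V"
  unfolding copies_def by (rule order.trans[OF card_image_le[OF finite_embeddings] card_embeddings_le])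

text \<open>The number is a falling factorial, and each factor satisfies
  \<open>n \<le> card V * (n - i)\<close> for \<open>i < card V \<le> n\<close>.\<close>

lemma card_embeddings_ge:
  assumes "card V \<le> n"
  shows "n ^ card V \<le> card V ^ card V * card (embeddings V n)"
proof -
  have "n \<le> card V * (n - i)" if i: "i < card V" for i
  proof -
    obtain m where m: "n = card V + m" using le_Suc_ex[OF assms] by blast
    obtain k where k: "card V = Suc i + k" using le_Suc_ex[OF Suc_leI[OF i]] by blast
    have "n - i = Suc k + m" using m k by simp
    then show ?thesis using m k by (simp add: algebra_simps)
  qed
  then have "(\<Prod>i\<in>{0..<card V}. n) \<le> (\<Prod>i\<in>{0..<card V}. card V * (n - i))"
    by (intro prod_mono) auto
  then show ?thesis
    using card_inj_on_subset_funcset[OF finite_V, of "{..<n}" V]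
    by (simp add: embeddings_def prod.distrib)
qed

text \<open>Embeddings with the same edge image share the vertex image, so at most
  \<open>card V ^ card V\<close> of them give one copy.\<close>

lemma card_embeddings_le_copies: "card (embeddings V n) \<le> card V ^ card V * card (copies V E n)"
proof -
  define h where "h = (\<lambda>f :: 'a \<Rightarrow> nat. (`) f ` E)"
  have "card (embeddings V n) = (\<Sum>f\<in>embeddings V n. 1)" by simp
  also have "\<dots> = (\<Sum>F\<in>h ` embeddings V n. \<Sum>f\<in>{f \<in> embeddings V n. h f = F}. 1)"
    by (rule sum.image_gen[OF finite_embeddings])
  also have "\<dots> \<le> (\<Sum>F\<in>h ` embeddings V n. card V ^ card V)"
  proof (rule sum_mono)
    fix F assume "F \<in> h ` embeddings V n"
    then obtain g where g: "g \<in> embeddings V n" "F = h g" by auto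
    have U: "\<Union>(h f) = f ` V" for f by (auto simp: h_def spanned[symmetric])
    have "card (g ` V) = card V" using g by (auto simp: embeddings_def card_image)
    moreover have "{f \<in> embeddings V n. h f = F} \<subseteq> V \<rightarrow>\<^sub>E g ` V"
    proof
      fix f assume "f \<in> {f \<in> embeddings V n. h f = F}"
      then have "f \<in> V \<rightarrow>\<^sub>E {..<n}" "f ` V = g ` V" using U[of f] U[of g] g by (auto simp: embeddings_def)
      then show "f \<in> V \<rightarrow>\<^sub>E g ` V" by (auto simp: PiE_def)
    qed
    then have "card {f \<in> embeddings V n. h f = F} \<le> card (V \<rightarrow>\<^sub>E g ` V)"
      using finite_V by (intro card_mono finite_PiE) auto
    ultimately show "(\<Sum>f\<in>{f \<in> embeddings V n. h f = F}. 1) \<le> card V ^ card V"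
      by (simp add: card_funcsetE finite_V)
  qed
  finally show ?thesis by (simp add: copies_def h_def mult.commute)
qed

lemma card_copies_ge:
  assumes "card V \<le> n"
  shows "n ^ card V \<le> (card V ^ card V)\<^sup>2 * card (copies V E n)"
proof -
  have "n ^ card V \<le> card V ^ card V * card (embeddings V n)" by (rule card_embeddings_ge[OF assms])
  also have "\<dots> \<le> card V ^ card V * (card V ^ card V * card (copies V E n))"
    by (intro mult_left_mono card_embeddings_le_copies) auto
  finally show ?thesis by (simp add: power2_eq_square mult.assoc)
qed

text \<open>An embedding is classified by the set \<open>K\<close> of edges that it sends into \<open>H\<close>; the vertices of
  \<open>K\<close> have boundedly many possible images and the others at most \<open>n\<close>.\<close>

lemma sum_overlapping_copies_le:
  fixes p \<Psi> :: real
  assumes p: "0 < p" "p < 1" and \<Psi>: "0 < \<Psi>"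
    and \<Psi>_le: "\<And>K. K \<subseteq> E \<Longrightarrow> K \<noteq> {} \<Longrightarrow> \<Psi> \<le> real n ^ card (\<Union>K) * p ^ card K"
    and H: "finite H" "H \<subseteq> nsets {..<n} 2" "2 * card H \<le> m" "1 \<le> m"
  shows "(\<Sum>F\<in>{F \<in> copies V E n. F \<inter> H \<noteq> {}}. p ^ card (F - H))
    \<le> 2 ^ card E * real m ^ card V * (real n ^ card V * p ^ card E / \<Psi>)"
proof -
  define h where "h = (\<lambda>f :: 'a \<Rightarrow> nat. (`) f ` E)"
  define M where "M = {f \<in> embeddings V n. h f \<inter> H \<noteq> {}}"
  define \<kappa> where "\<kappa> = (\<lambda>f :: 'a \<Rightarrow> nat. {e \<in> E. f ` e \<in> H})"
  have finM: "finite M" using finite_embeddings by (simp add: M_def)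
  have cardUH: "card (\<Union>H) \<le> m"
  proof -
    have "card (\<Union>H) \<le> (\<Sum>e\<in>H. card e)" by (rule card_Union_le_sum_card)
    also have "\<dots> = (\<Sum>e\<in>H. 2)" using H(2) by (intro sum.cong) (auto simp: nsets_def)
    finally show ?thesis using H(3) by simp
  qed
  have finUH: "finite (\<Union>H)" using H by (auto simp: nsets_def)
  have "(\<Sum>F\<in>{F \<in> copies V E n. F \<inter> H \<noteq> {}}. p ^ card (F - H)) = (\<Sum>F\<in>h ` M. p ^ card (F - H))"
    by (rule sum.cong) (auto simp: copies_def h_def M_def)
  \<comment> \<open>Summing over embeddings counts every copy at least once, and the terms are
    nonnegative.\<close>
  also have "\<dots> \<le> (\<Sum>f\<in>M. p ^ card (h f - H))"
    using sum_image_le[OF finM, of "\<lambda>F. p ^ card (F - H)" h] p by (simp add: o_def)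
  also have "\<dots> = (\<Sum>f\<in>M. p ^ (card E - card (\<kappa> f)))"
  proof (intro sum.cong refl arg_cong[where f = "power p"])
    fix f assume "f \<in> M"
    then have inj: "inj_on ((`) f) E" using inj_on_image_edges by (auto simp: M_def)
    have "h f - H = (`) f ` (E - \<kappa> f)" by (auto simp: h_def \<kappa>_def)
    moreover have "inj_on ((`) f) (E - \<kappa> f)" using inj by (rule inj_on_subset) auto
    ultimately have "card (h f - H) = card (E - \<kappa> f)" by (simp add: card_image)
    also have "\<dots> = card E - card (\<kappa> f)"
      using finite_E by (intro card_Diff_subset) (auto simp: \<kappa>_def intro: finite_subset)
    finally show "card (h f - H) = card E - card (\<kappa> f)" .
  qed
  \<comment> \<open>The empty class is absent because the image of every \<open>f\<close> in
    \<open>M\<close> shares an edge with \<open>H\<close>.\<close>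
  also have "\<dots> = (\<Sum>K\<in>Pow E - {{}}. \<Sum>f\<in>{f \<in> M. \<kappa> f = K}. p ^ (card E - card (\<kappa> f)))"
    using finM finite_E by (intro sum.group[symmetric]) (auto simp: \<kappa>_def M_def h_def)
  also have "\<dots> \<le> (\<Sum>K\<in>Pow E - {{}}. real m ^ card V * (real n ^ card V * p ^ card E / \<Psi>))"
  proof (rule sum_mono)
    fix K assume K: "K \<in> Pow E - {{}}"
    then have K': "K \<subseteq> E" "K \<noteq> {}" by auto
    have UK: "\<Union>K \<subseteq> V" using K' spanned by auto
    have finUK: "finite (\<Union>K)" using UK finite_V finite_subset by blast
    \<comment> \<open>A vertex on an edge of \<open>K\<close> must land on an endpoint of an edge of
      \<open>H\<close>.\<close>
    define B where "B = (\<lambda>v. if v \<in> \<Union>K then \<Union>H else {..<n})"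
    have "{f \<in> M. \<kappa> f = K} \<subseteq> Pi\<^sub>E V B"
      by (auto simp: M_def \<kappa>_def B_def embeddings_def PiE_def Pi_def)
    then have "card {f \<in> M. \<kappa> f = K} \<le> card (Pi\<^sub>E V B)"
      using finite_V finUH by (intro card_mono finite_PiE) (auto simp: B_def)
    also have "\<dots> = (\<Prod>v\<in>V. card (B v))" by (rule card_PiE[OF finite_V])
    also have "\<dots> = (\<Prod>v\<in>\<Union>K. card (B v)) * (\<Prod>v\<in>V - \<Union>K. card (B v))"
      using prod.subset_diff[OF UK finite_V, of "\<lambda>v. card (B v)"] by (simp add: mult.commute)
    also have "(\<Prod>v\<in>\<Union>K. card (B v)) = card (\<Union>H) ^ card (\<Union>K)"
      by (simp add: B_def)
    also have "(\<Prod>v\<in>V - \<Union>K. card (B v)) = n ^ (card V - card (\<Union>K))"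
      using UK finUK by (simp add: B_def card_Diff_subset)
    also have "card (\<Union>H) ^ card (\<Union>K) * n ^ (card V - card (\<Union>K)) \<le> m ^ card V * n ^ (card V - card (\<Union>K))"
    proof (rule mult_right_mono)
      have "card (\<Union>H) ^ card (\<Union>K) \<le> m ^ card (\<Union>K)" using cardUH by (intro power_mono) auto
      also have "\<dots> \<le> m ^ card V"
        using UK finite_V H(4) by (intro power_increasing card_mono) auto
      finally show "card (\<Union>H) ^ card (\<Union>K) \<le> m ^ card V" .
    qed simp
    finally have "real (card {f \<in> M. \<kappa> f = K}) \<le> real (m ^ card V * n ^ (card V - card (\<Union>K)))"
      by (rule of_nat_mono)
    then have "(\<Sum>f\<in>{f \<in> M. \<kappa> f = K}. p ^ (card E - card (\<kappa> f)))
       \<le> real m ^ card V * real n ^ (card V - card (\<Union>K)) * p ^ (card E - card K)"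
      using p by (simp add: mult_right_mono del: mult_le_cancel_right)
    also have "\<dots> = real m ^ card V * (real n ^ (card V - card (\<Union>K)) * p ^ (card E - card K))"
      by simp
    also have "\<dots> \<le> real m ^ card V * (real n ^ card V * p ^ card E / \<Psi>)"
    proof (rule mult_left_mono)
      have le: "card (\<Union>K) \<le> card V" "card K \<le> card E"
        using UK K' finite_V finite_E by (auto intro: card_mono)
      have "\<Psi> * (real n ^ (card V - card (\<Union>K)) * p ^ (card E - card K))
         \<le> real n ^ card (\<Union>K) * p ^ card K * (real n ^ (card V - card (\<Union>K)) * p ^ (card E - card K))"
        using p by (intro mult_right_mono \<Psi>_le K') auto
      also have "\<dots> = real n ^ (card (\<Union>K) + (card V - card (\<Union>K))) * p ^ (card K + (card E - card K))"
        by (simp only: power_add mult_ac)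
      also have "\<dots> = real n ^ card V * p ^ card E" using le by simp
      finally show "real n ^ (card V - card (\<Union>K)) * p ^ (card E - card K) \<le> real n ^ card V * p ^ card E / \<Psi>"
        using \<Psi> by (simp add: field_simps)
    qed simp
    finally show "(\<Sum>f\<in>{f \<in> M. \<kappa> f = K}. p ^ (card E - card (\<kappa> f)))
        \<le> real m ^ card V * (real n ^ card V * p ^ card E / \<Psi>)" .
  qed
  also have "\<dots> = real (card (Pow E - {{}})) * (real m ^ card V * (real n ^ card V * p ^ card E / \<Psi>))"
    by simp
  also have "\<dots> \<le> 2 ^ card E * (real m ^ card V * (real n ^ card V * p ^ card E / \<Psi>))"
  proof (rule mult_right_mono)
    have "card (Pow E - {{}}) \<le> card (Pow E)" using finite_E by (intro card_mono) auto
    then show "real (card (Pow E - {{}})) \<le> 2 ^ card E"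
      using finite_E by (simp add: card_Pow flip: of_nat_le_iff[where 'a = real])
  qed (use p \<Psi> in auto)
  finally show ?thesis by (simp add: mult.assoc)
qed

end

section \<open>The normal approximation of tree counts\<close>

text \<open>On the support all coordinates outside \<open>D\<close> are \<open>False\<close>, so
  passing from configurations to subsets is injective and point masses are products.\<close>

lemma (in random_subset) expectation_bernoulli_subset:
  "measure_pmf.expectation (map_pmf (\<lambda>\<omega>. {e \<in> D. \<omega> e}) (Pi_pmf D False (\<lambda>_. bernoulli_pmf p))) g = ex g"
proof -
  define P where "P = Pi_pmf D False (\<lambda>_. bernoulli_pmf p)"
  define S where "S = (\<lambda>\<omega>. {e \<in> D. \<omega> e})"
  have set_P: "set_pmf P = {f. \<forall>x. x \<notin> D \<longrightarrow> f x = False}"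
    using p_pos p_less_1 finite_D by (simp add: P_def set_Pi_pmf PiE_dflt_def)
  have inj: "inj_on S (set_pmf P)"
    unfolding set_P by (rule inj_onI) (auto simp: S_def fun_eq_iff set_eq_iff)
  have "pmf (map_pmf S P) H = weight H" if "H \<subseteq> D" for H
  proof -
    have "H = S (\<lambda>x. x \<in> H)" using that by (auto simp: S_def)
    then have "pmf (map_pmf S P) H = pmf (map_pmf S P) (S (\<lambda>x. x \<in> H))" by simp
    also have "\<dots> = pmf P (\<lambda>x. x \<in> H)"
      by (rule pmf_map_inj[OF inj]) (use that in \<open>auto simp: set_P\<close>)
    also have "\<dots> = (\<Prod>x\<in>D. pmf (bernoulli_pmf p) (x \<in> H))"
      unfolding P_def by (rule pmf_Pi'[OF finite_D]) (use that in auto)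
    also have "\<dots> = (\<Prod>x\<in>D. if x \<in> H then p else 1 - p)"
      using p_pos p_less_1 by (intro prod.cong) auto
    also have "\<dots> = weight H"
      using finite_D that by (simp add: prod.If_cases weight_def Int_absorb1 Diff_eq)
    finally show ?thesis .
  qed
  then have "measure_pmf.expectation (map_pmf S P) g = (\<Sum>H\<in>Pow D. g H * weight H)"
    using finite_D by (subst integral_measure_pmf_real[of "Pow D"]) (auto simp: S_def)
  then show ?thesis by (simp add: ex_def S_def P_def mult.commute)
qed

text \<open>\<open>x ^ (k + 1) * p ^ k = x * (x * p) ^ k\<close> is monotone in \<open>k\<close>, so
  the least value is taken at \<open>k = 1\<close> or \<open>k = r\<close>.\<close>

lemma smallest_subtree_weight:
  fixes p x :: real
  assumes "1 \<le> x" "0 < p" "1 \<le> k" "k \<le> r" "k + 1 \<le> u"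
  shows "min (x ^ 2 * p) (x ^ (r + 1) * p ^ r) \<le> x ^ u * p ^ k"
proof -
  have "min (x ^ 2 * p) (x ^ (r + 1) * p ^ r) \<le> x * (x * p) ^ k"
  proof (cases "1 \<le> x * p")
    case True
    have "x * (x * p) ^ 1 \<le> x * (x * p) ^ k"
      using assms True by (intro mult_left_mono power_increasing) auto
    then show ?thesis by (simp add: power2_eq_square mult.assoc)
  next
    case False
    have "x * (x * p) ^ r \<le> x * (x * p) ^ k"
      using assms False by (intro mult_left_mono power_decreasing) auto
    then show ?thesis by (simp add: power_mult_distrib mult.assoc)
  qed
  also have "\<dots> = x ^ (k + 1) * p ^ k" by (simp add: power_mult_distrib)
  also have "\<dots> \<le> x ^ u * p ^ k"
    using assms by (intro mult_right_mono power_increasing) auto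
  finally show ?thesis .
qed

text \<open>The constant of \<open>sum_overlapping_copies_le\<close> for \<open>r\<close> edges,
  \<open>r + 1\<close> vertices and \<open>m = 6 * r\<close>, twice the \<open>3 * r\<close> edges
  of three copies.\<close>

definition subtree_constant :: "nat \<Rightarrow> real" where
  "subtree_constant r = 2 ^ r * real (6 * r) ^ (r + 1)"

text \<open>The lower bound from \<open>card_copies_ge\<close> for the number of copies divided by
  \<open>n ^ (r + 1)\<close>.\<close>

definition copy_density :: "nat \<Rightarrow> real" where
  "copy_density r = 1 / (real ((r + 1) ^ (r + 1)))\<^sup>2"

text \<open>The factor \<open>8 r^2\<close> comes from \<open>normal_approximation_links\<close>,
  the root from \<open>link_weight_le\<close>, the denominator from the variance bound.\<close>

definition tree_constant :: "nat \<Rightarrow> real" where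
  "tree_constant r = 8 * (real r)\<^sup>2 * sqrt (2 * subtree_constant r ^ 3) / (copy_density r)\<^sup>2"

lemma subtree_constant_pos: "1 \<le> r \<Longrightarrow> 0 < subtree_constant r"
  unfolding subtree_constant_def by (intro mult_pos_pos zero_less_power) auto

lemma self_power_pos: "0 < real ((r + 1) ^ (r + 1))"
  by (simp only: of_nat_0_less_iff) (intro zero_less_power, simp)

lemma copy_density_pos: "0 < copy_density r"
  unfolding copy_density_def by (intro divide_pos_pos zero_less_power self_power_pos) simp

lemma copy_density_le_1: "copy_density r \<le> 1"
proof -
  have "1 \<le> real ((r + 1) ^ (r + 1))"
    using one_le_power[of "r + 1" "r + 1"] by linarith
  then show ?thesis
    unfolding copy_density_def using one_le_power[of "real ((r + 1) ^ (r + 1))" 2]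
    by (subst divide_le_eq_1) auto
qed

lemma tree_constant_pos: "1 \<le> r \<Longrightarrow> 0 < tree_constant r"
  unfolding tree_constant_def using subtree_constant_pos copy_density_pos
  by (intro divide_pos_pos mult_pos_pos zero_less_power) auto

text \<open>With \<open>q = 1 - p\<close>, \<open>link_weight\<close> is of order at most
  \<open>M^4 / \<Psi>^3\<close> and the variance at least of order \<open>q * M^2 / \<Psi>\<close>;
  in the quotient \<open>M\<close> cancels and \<open>sqrt (q * \<Psi>)\<close> remains
  below.\<close>

lemma normal_approx_error_tree:
  fixes p :: real
  assumes tree: "is_tree V E" "card E = r" "1 \<le> r" and p: "0 < p" "p < 1" and n: "card V \<le> n"
  shows "normal_approx_error V E n p
    \<le> tree_constant r / sqrt ((1 - p) * min (real n ^ 2 * p) (real n ^ (r + 1) * p ^ r))"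
proof -
  note tp = tree_properties[OF tree(1), unfolded tree(2), OF tree(3)]
  interpret spanned_graph V E
    using tp by unfold_locales auto
  define D :: "nat set set" where "D = nsets {..<n} 2"
  have finD: "finite D" unfolding D_def by (rule finite_imp_finite_nsets) simp
  \<comment> \<open>Any enumeration of the edges will do as the revealing order.\<close>
  obtain rk :: "nat set \<Rightarrow> nat" where rk: "inj_on rk D"
    using finite_imp_inj_to_nat_seg[OF finD] by blast
  interpret subset_count D p "copies V E n" r rk
    using finD p rk copies_nsets card_copy tree(2)
    by unfold_locales (auto simp: D_def)
  define q where "q = 1 - p"
  define N where "N = real n"
  define M where "M = N ^ (r + 1) * p ^ r"
  define \<Psi> where "\<Psi> = min (N ^ 2 * p) M"
  define C where "C = subtree_constant r"
  define \<kappa> where "\<kappa> = copy_density r"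
  have cardV: "card V = r + 1" using tp by simp
  have N1: "1 \<le> N" using n cardV by (simp add: N_def)
  have q: "0 < q" "q < 1" using p by (auto simp: q_def)
  have M: "0 < M" using N1 p by (simp add: M_def)
  have \<Psi>: "0 < \<Psi>" using N1 p M by (simp add: \<Psi>_def)
  have \<kappa>: "0 < \<kappa>" "\<kappa> \<le> 1"
    by (simp_all add: \<kappa>_def copy_density_pos copy_density_le_1)
  have C: "0 \<le> C" using subtree_constant_pos[OF tree(3)] by (simp add: C_def)
  have copies_ge: "\<kappa> * N ^ (r + 1) \<le> real (card (copies V E n))"
  proof -
    have "real (n ^ (r + 1)) \<le> real (((r + 1) ^ (r + 1))\<^sup>2 * card (copies V E n))"
      using card_copies_ge[OF n] unfolding cardV by (rule of_nat_mono)
    then have *: "N ^ (r + 1) \<le> (real ((r + 1) ^ (r + 1)))\<^sup>2 * real (card (copies V E n))"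
      by (simp only: N_def of_nat_power of_nat_mult)
    have "\<kappa> * N ^ (r + 1) \<le> \<kappa> * ((real ((r + 1) ^ (r + 1)))\<^sup>2 * real (card (copies V E n)))"
      by (rule mult_left_mono[OF *]) (use \<kappa> in simp)
    also have "\<dots> = real (card (copies V E n))"
      using self_power_pos[of r] unfolding \<kappa>_def copy_density_def by (simp del: of_nat_power)
    finally show ?thesis .
  qed
  have copies_le: "real (card (copies V E n)) \<le> N ^ (r + 1)"
    using card_copies_le[of n] unfolding cardV N_def by (metis of_nat_le_iff of_nat_power)
  have mean_le: "mean \<le> M"
    unfolding mean_def M_def using copies_le p by (intro mult_right_mono) auto
  have mean_nonneg: "0 \<le> mean" using p by (simp add: mean_def)
  have link: "link_weight \<le> 2 * mean * (C * (M / \<Psi>)) ^ 3"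
  proof (rule link_weight_le)
    fix H assume H: "finite H" "H \<subseteq> D" "card H \<le> 3 * r"
    have "(\<Sum>A\<in>{A \<in> copies V E n. A \<inter> H \<noteq> {}}. p ^ card (A - H))
      \<le> 2 ^ card E * real (6 * r) ^ card V * (real n ^ card V * p ^ card E / \<Psi>)"
    proof (rule sum_overlapping_copies_le[OF p \<Psi>])
      fix K assume K: "K \<subseteq> E" "K \<noteq> {}"
      show "\<Psi> \<le> real n ^ card (\<Union>K) * p ^ card K"
        unfolding \<Psi>_def M_def N_def[symmetric]
      proof (rule smallest_subtree_weight)
        show "1 \<le> card K" using K finite_E finite_subset by (simp add: Suc_le_eq card_gt_0_iff)
        show "card K \<le> r" using card_mono[OF finite_E K(1)] tree(2) by simp
      qed (use tp(6)[OF K] N1 p in auto)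
    qed (use H tree(3) in \<open>auto simp: D_def\<close>)
    then show "(\<Sum>A\<in>{A \<in> copies V E n. A \<inter> H \<noteq> {}}. p ^ card (A - H)) \<le> C * (M / \<Psi>)"
      unfolding tree(2) cardV N_def[symmetric] by (simp add: C_def subtree_constant_def M_def)
  qed
  also have "\<dots> \<le> 2 * M * (C * (M / \<Psi>)) ^ 3"
    using mean_le C M \<Psi> by (intro mult_right_mono) auto
  finally have link': "link_weight \<le> 2 * M * (C * (M / \<Psi>)) ^ 3" .
  \<comment> \<open>The overlap bound serves when \<open>N^2 * p\<close>, which dominates
    \<open>card D * p\<close>, is the minimum, and the diagonal bound when \<open>M\<close>
    is.\<close>
  have var_ge: "\<kappa>\<^sup>2 * q * M\<^sup>2 / \<Psi> \<le> var"
  proof (cases "N ^ 2 * p \<le> M")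
    case True
    have "card D \<le> n\<^sup>2"
    proof -
      have "card D = n choose 2" by (simp only: D_def binomial_eq_nsets lessThan_atLeast0)
      also have "\<dots> \<le> n\<^sup>2" by (rule binomial_le_pow) (use n cardV tree(3) in simp)
      finally show ?thesis .
    qed
    then have D: "real (card D) \<le> N ^ 2" by (simp add: N_def flip: of_nat_power)
    have var0: "0 \<le> var" unfolding var_def by (rule ex_nonneg) simp
    have "p ^ (2 * r - 1) * q * (\<kappa> * N ^ (r + 1))\<^sup>2 \<le> p ^ (2 * r - 1) * q * (real (card (copies V E n)))\<^sup>2"
      using copies_ge \<kappa> N1 p q by (intro mult_left_mono power_mono) auto
    also have "\<dots> \<le> real (card D) * var"
      unfolding q_def by (rule var_ge_overlap[OF tree(3)])
    also have "\<dots> \<le> N ^ 2 * var" by (rule mult_right_mono[OF D var0])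
    finally have "p * (p ^ (2 * r - 1) * q * (\<kappa> * N ^ (r + 1))\<^sup>2) \<le> p * (N ^ 2 * var)"
      using p by (intro mult_left_mono) auto
    moreover have "p * (p ^ (2 * r - 1) * q * (\<kappa> * N ^ (r + 1))\<^sup>2) = \<kappa>\<^sup>2 * q * M\<^sup>2"
    proof -
      have "p * p ^ (2 * r - 1) = p ^ Suc (2 * r - 1)" by simp
      also have "Suc (2 * r - 1) = r + r" using tree(3) by simp
      finally have "p * p ^ (2 * r - 1) = p ^ r * p ^ r" by (simp only: power_add)
      then show ?thesis by (simp add: M_def power2_eq_square mult_ac)
    qed
    ultimately have "\<kappa>\<^sup>2 * q * M\<^sup>2 \<le> p * (N ^ 2 * var)" by linarith
    also have "\<dots> = (N ^ 2 * p) * var" by simp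
    finally have "\<kappa>\<^sup>2 * q * M\<^sup>2 \<le> (N ^ 2 * p) * var" .
    moreover have "\<Psi> = N ^ 2 * p" using True by (simp add: \<Psi>_def)
    ultimately show ?thesis using \<Psi> by (simp add: pos_divide_le_eq mult.commute)
  next
    case False
    then have "\<Psi> = M" by (simp add: \<Psi>_def)
    then have "\<kappa>\<^sup>2 * q * M\<^sup>2 / \<Psi> = \<kappa> * (\<kappa> * (M * q))" using M by (simp add: power2_eq_square)
    also have "\<dots> \<le> 1 * (\<kappa> * (M * q))"
      using \<kappa> M q by (intro mult_right_mono) auto
    also have "\<dots> = (\<kappa> * N ^ (r + 1)) * (p ^ r * q)" by (simp add: M_def)
    also have "\<dots> \<le> real (card (copies V E n)) * (p ^ r * q)"
      using copies_ge p q by (intro mult_right_mono) auto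
    also have "\<dots> \<le> var" unfolding q_def by (rule var_ge_diagonal[OF tree(3)])
    finally show ?thesis .
  qed
  have low: "0 < \<kappa>\<^sup>2 * q * M\<^sup>2 / \<Psi>" using \<kappa> q M \<Psi> by simp
  then have var_pos: "0 < var" using var_ge by linarith
  have bound: "\<bar>ex (\<lambda>H. of_bool ((total H - mean) / sqrt var \<le> z)) - std_normal_cdf z\<bar>
      \<le> tree_constant r / sqrt (q * \<Psi>)" for z
  proof -
    have "(1 - p) * link_weight \<le> q * (2 * M * (C * (M / \<Psi>)) ^ 3)"
      using link' q unfolding q_def by (intro mult_left_mono) auto
    \<comment> \<open>Arranged as a square over \<open>q * \<Psi>\<close>, so that the root extracts
      the order of the variance bound.\<close>
    also have "\<dots> = (2 * C ^ 3) * ((q * M\<^sup>2 / \<Psi>)\<^sup>2 / (q * \<Psi>))"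
      using q \<Psi> by (simp add: field_simps power2_eq_square power3_eq_cube)
    finally have "sqrt ((1 - p) * link_weight) \<le> sqrt ((2 * C ^ 3) * ((q * M\<^sup>2 / \<Psi>)\<^sup>2 / (q * \<Psi>)))"
      by (rule real_sqrt_le_mono)
    also have "\<dots> = sqrt (2 * C ^ 3) * ((q * M\<^sup>2 / \<Psi>) / sqrt (q * \<Psi>))"
      unfolding real_sqrt_mult[of "2 * C ^ 3"] real_sqrt_divide real_sqrt_abs using q \<Psi> by simp
    finally have sq: "sqrt ((1 - p) * link_weight) \<le> sqrt (2 * C ^ 3) * ((q * M\<^sup>2 / \<Psi>) / sqrt (q * \<Psi>))" .
    have "8 * (real r)\<^sup>2 * sqrt ((1 - p) * link_weight) / var
        \<le> 8 * (real r)\<^sup>2 * (sqrt (2 * C ^ 3) * ((q * M\<^sup>2 / \<Psi>) / sqrt (q * \<Psi>))) / (\<kappa>\<^sup>2 * q * M\<^sup>2 / \<Psi>)"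
      using sq var_ge low q \<Psi> C M by (intro frac_le mult_left_mono) auto
    also have "\<dots> = tree_constant r / sqrt (q * \<Psi>)"
    proof -
      define T where "T = q * M\<^sup>2 / \<Psi>"
      have "T \<noteq> 0" "\<kappa>\<^sup>2 * q * M\<^sup>2 / \<Psi> = \<kappa>\<^sup>2 * T" using q M \<Psi> by (auto simp: T_def)
      then show ?thesis unfolding T_def[symmetric] tree_constant_def C_def[symmetric] \<kappa>_def[symmetric]
        using \<kappa> by (simp add: mult_ac)
    qed
    finally show ?thesis using normal_approximation_links[OF var_pos, of z] by linarith
  qed
  have ER: "measure_pmf.expectation (erdos_renyi n p) g = ex g" for g
    unfolding erdos_renyi_def D_def[symmetric] by (rule expectation_bernoulli_subset)
  \<comment> \<open>\<open>ex\<close> looks only at subsets of \<open>D\<close>, where the subgraph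
    count is identified with \<open>total\<close>.\<close>
  have cong: "ex g = ex h" if "\<And>H. H \<subseteq> D \<Longrightarrow> g H = h H" for g h
    unfolding ex_def using that by (intro sum.cong) auto
  have count: "real (subgraph_count V E {..<n} H) = total H" if "H \<subseteq> D" for H
    using that finite_T unfolding D_def
    by (simp add: subgraph_count_eq total_def monomial_def of_bool_def sum.If_cases Collect_conj_eq)
  have mean: "ex (\<lambda>H. real (subgraph_count V E {..<n} H)) = mean"
  proof -
    have "ex (\<lambda>H. real (subgraph_count V E {..<n} H)) = ex total" by (rule cong) (simp add: count)
    also have "\<dots> = mean"
      unfolding total_def[abs_def] ex_sum mean_def by (simp add: ex_monomial members card_member)
    finally show ?thesis .
  qed
  have var: "ex (\<lambda>H. (real (subgraph_count V E {..<n} H) - mean)\<^sup>2) = var"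
    unfolding var_def by (rule cong) (simp add: count)
  have norm: "normalized_count V E n p H = (total H - mean) / sqrt var" if "H \<subseteq> D" for H
    unfolding normalized_count_def Let_def ER mean var using count[OF that] by simp
  have "cdf (distr (measure_pmf (erdos_renyi n p)) borel (normalized_count V E n p)) z
      = ex (\<lambda>H. of_bool ((total H - mean) / sqrt var \<le> z))" for z
  proof -
    have "cdf (distr (measure_pmf (erdos_renyi n p)) borel (normalized_count V E n p)) z
       = measure_pmf.prob (erdos_renyi n p) {H. normalized_count V E n p H \<le> z}"
      by (simp add: cdf_def measure_distr vimage_def)
    also have "\<dots> = measure_pmf.expectation (erdos_renyi n p) (indicator {H. normalized_count V E n p H \<le> z})"
      by simp
    also have "\<dots> = ex (\<lambda>H. of_bool ((total H - mean) / sqrt var \<le> z))"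
      unfolding ER by (rule cong) (simp add: norm indicator_def)
    finally show ?thesis .
  qed
  then have "kolmogorov_dist (distr (measure_pmf (erdos_renyi n p)) borel (normalized_count V E n p))
      std_normal_distribution \<le> tree_constant r / sqrt (q * \<Psi>)"
    unfolding kolmogorov_dist_def using bound by (intro cSUP_least) auto
  then show ?thesis
    by (simp add: normal_approx_error_def q_def \<Psi>_def M_def N_def)
qed

section \<open>The three ranges of the edge probability\<close>

theorem corollary4p6:
  fixes V :: "'a set" and E :: "'a set set" and r :: nat and c :: real
  assumes "is_tree V E" and "card E = r" and "r \<ge> 1"
    and "0 < c" and "c < 1"
  shows "\<exists>C::real. C > 0 \<and>
    (\<forall>p :: nat \<Rightarrow> real. (\<forall>n. 0 < p n \<and> p n < 1) \<longrightarrow>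
      (\<forall>n \<ge> card V.
        (c < p n \<and> p n < 1 \<longrightarrow>
           normal_approx_error V E n (p n) \<le> C * (1 / (real n * sqrt (1 - p n)))) \<and>
        (1 / real n < p n \<and> p n \<le> c \<longrightarrow>
           normal_approx_error V E n (p n) \<le> C * (1 / (real n * sqrt (p n)))) \<and>
        (0 < p n \<and> p n \<le> 1 / real n \<longrightarrow>
           normal_approx_error V E n (p n)
             \<le> C * (1 / (real n powr ((real r + 1) / 2) * p n powr (real r / 2))))))"
proof -
  \<comment> \<open>\<open>c ^ r\<close> serves the range above \<open>c\<close>,
    \<open>1 - c\<close> the middle range and \<open>1 / 2\<close> the range up to
    \<open>1 / n\<close>.\<close>
  define a where "a = min (min (c ^ r) (1 - c)) (1 / 2)"
  have a: "0 < a" "a \<le> c ^ r" "a \<le> 1 - c"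
    using assms(4,5) by (auto simp: a_def)
  have a_half: "a \<le> 1 / 2"
    unfolding a_def by (rule min.cobounded2)
  define C where "C = tree_constant r / sqrt a"
  have C: "0 < C" using a tree_constant_pos[OF assms(3)] by (simp add: C_def)
  \<comment> \<open>\<open>y\<close> is the inverse square of the claimed rate; each range only has
    to compare it with \<open>(1 - p)\<close> times the minimum.\<close>
  have main: "normal_approx_error V E n p \<le> C * (1 / sqrt y)"
    if p: "0 < p" "p < 1" and n: "card V \<le> n" and y: "0 < y"
      "a * y \<le> (1 - p) * min (real n ^ 2 * p) (real n ^ (r + 1) * p ^ r)" for n p y
  proof -
    have "normal_approx_error V E n p
        \<le> tree_constant r / sqrt ((1 - p) * min (real n ^ 2 * p) (real n ^ (r + 1) * p ^ r))"
      by (rule normal_approx_error_tree[OF assms(1-3) p n])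
    also have "\<dots> \<le> tree_constant r / sqrt (a * y)"
      using real_sqrt_le_mono[OF y(2)] mult_pos_pos[OF a(1) y(1)] tree_constant_pos[OF assms(3)]
      by (intro frac_le) auto
    finally show ?thesis by (simp add: C_def real_sqrt_mult)
  qed
  have cardV: "card V = r + 1"
    using tree_properties(4)[OF assms(1)] assms(2,3) by simp
  show ?thesis
  proof (intro exI[of _ C] conjI C allI impI; (elim conjE)?)
    fix p :: "nat \<Rightarrow> real" and n
    assume pr: "\<forall>n. 0 < p n \<and> p n < 1" and n: "card V \<le> n"
    define x where "x = real n"
    have x: "2 \<le> x" using n cardV assms(3) by (simp add: x_def)
    have p: "0 < p n" "p n < 1" using pr by auto
    {
      assume large: "c < p n"
      have "c ^ r \<le> p n" "c ^ r * x ^ 2 \<le> x ^ (r + 1) * p n ^ r"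
      proof -
        have "c ^ r \<le> c ^ 1" using assms(3-5) by (intro power_decreasing) auto
        then show "c ^ r \<le> p n" using large by simp
        have "c ^ r * x ^ 2 \<le> p n ^ r * x ^ (r + 1)"
          using large assms(3,4) x p by (intro mult_mono power_mono power_increasing) auto
        then show "c ^ r * x ^ 2 \<le> x ^ (r + 1) * p n ^ r" by (simp add: mult.commute)
      qed
      then have "c ^ r * x ^ 2 \<le> min (x ^ 2 * p n) (x ^ (r + 1) * p n ^ r)"
        using x by (simp add: mult.commute)
      moreover have "a * x ^ 2 \<le> c ^ r * x ^ 2" using a by (intro mult_right_mono) auto
      ultimately have "(1 - p n) * (a * x ^ 2) \<le> (1 - p n) * min (x ^ 2 * p n) (x ^ (r + 1) * p n ^ r)"
        using p by (intro mult_left_mono) auto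
      then have "normal_approx_error V E n (p n) \<le> C * (1 / sqrt (x ^ 2 * (1 - p n)))"
        using p x n by (intro main) (auto simp: x_def mult_ac)
      then show "normal_approx_error V E n (p n) \<le> C * (1 / (real n * sqrt (1 - p n)))"
        by (simp add: real_sqrt_mult x_def)
    next
      assume mid: "1 / real n < p n" "p n \<le> c"
      \<comment> \<open>At least one expected edge per vertex up to constants, so the single edge
        attains the minimum.\<close>
      then have "1 \<le> x * p n" using x by (simp add: x_def field_simps)
      then have "x * (x * p n) ^ 1 \<le> x * (x * p n) ^ r"
        using x assms(3) by (intro mult_left_mono power_increasing) auto
      then have "min (x ^ 2 * p n) (x ^ (r + 1) * p n ^ r) = x ^ 2 * p n"
        by (simp add: power_mult_distrib power2_eq_square mult_ac)
      moreover have "a * (x ^ 2 * p n) \<le> (1 - p n) * (x ^ 2 * p n)"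
        using a mid p by (intro mult_right_mono) auto
      ultimately have "normal_approx_error V E n (p n) \<le> C * (1 / sqrt (x ^ 2 * p n))"
        using p x n by (intro main) (auto simp: x_def)
      then show "normal_approx_error V E n (p n) \<le> C * (1 / (real n * sqrt (p n)))"
        by (simp add: real_sqrt_mult x_def)
    next
      assume small: "p n \<le> 1 / real n"
      then have le: "x * p n \<le> 1" using x by (simp add: x_def field_simps)
      then have "x * (x * p n) ^ r \<le> x * (x * p n) ^ 1"
        using x p assms(3) by (intro mult_left_mono power_decreasing) auto
      then have "min (x ^ 2 * p n) (x ^ (r + 1) * p n ^ r) = x ^ (r + 1) * p n ^ r"
        by (simp add: power_mult_distrib power2_eq_square mult_ac)
      \<comment> \<open>A tree with an edge has two vertices, so \<open>n \<ge> 2\<close> and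
        \<open>1 / n \<le> 1 / 2\<close>.\<close>
      moreover have "p n \<le> 1 / 2"
        using le mult_right_mono[OF x less_imp_le[OF p(1)]] by linarith
      then have "a * (x ^ (r + 1) * p n ^ r) \<le> (1 - p n) * (x ^ (r + 1) * p n ^ r)"
        using a_half p x by (intro mult_right_mono) auto
      ultimately have "normal_approx_error V E n (p n) \<le> C * (1 / sqrt (x ^ (r + 1) * p n ^ r))"
        using p x n by (intro main) (auto simp: x_def)
      moreover have "sqrt (x ^ (r + 1) * p n ^ r) = x powr ((real r + 1) / 2) * p n powr (real r / 2)"
      proof -
        have half: "sqrt (y ^ k) = y powr (real k / 2)" if "0 < y" for y :: real and k
          using that by (simp add: powr_half_sqrt[symmetric] powr_realpow[symmetric] powr_powr)
        show ?thesis using half[of x "r + 1"] half[of "p n" r] x p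
          by (simp add: real_sqrt_mult add.commute)
      qed
      ultimately show "normal_approx_error V E n (p n)
          \<le> C * (1 / (real n powr ((real r + 1) / 2) * p n powr (real r / 2)))"
        by (simp add: x_def)
    }
  qed
qed

end
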